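(* Let $B$ be a compact Hausdorff space, let $\Sigma$ be a Borel probability measure on $B^{\mathbb{N}}$, put $\mu=\Sigma\circ\pi_1^{-1}$, and let $(\mathbb{P}_x)_{x\in B}$ be the field of measures disintegrating $\Sigma$ along $\pi_1$ (each $\mathbb{P}_x$ a probability measure carried by $\pi_1^{-1}(x)$, and $d\Sigma=\int_B d\mathbb{P}_x\,d\mu(x)$). Then the following are equivalent: (a) there is a positive linear operator $R:C(B)\to C(B)$ with $R1=1$ such that for all $x\in B$, $n\in\mathbb{N}$ and $\varphi_1,\dots,\varphi_n\in C(B)$, $$\int_{B^{\mathbb{N}}}\varphi_1\otimes\dots\otimes\varphi_n\,d\mathbb{P}_x=\left(M_{\varphi_1}RM_{\varphi_2}\cdots RM_{\varphi_n}1\right)(x);$$ (b) there is a positive linear operator $R:C(B)\to C(B)$ with $R1=1$ such that $$\mathbb{E}_x(f\circ\sigma)=\bigl(R(\mathbb{E}_\bullet f)\bigr)(x)$$ for all $x\in B$ and all $f\in L^2(B^{\mathbb{N}},\Sigma)$.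
   Context: $\mathbb{N}=\{1,2,\dots\}$; $C(B)$ is the space of continuous functions $B\to\mathbb{R}$; $\pi_n(\tilde x)=x_n$ is the $n$-th coordinate map on $B^{\mathbb{N}}$, and $\pi_1^{-1}(x)=\{\tilde x\in B^{\mathbb{N}}:x_1=x\}$. $\sigma$ is the shift $\sigma(x_1,x_2,\dots)=(x_2,x_3,\dots)$. $R$ is positive if $\varphi\ge0$ implies $R\varphi\ge0$; $M_\varphi f=\varphi f$; $(\varphi_1\otimes\dots\otimes\varphi_n)(\tilde x)=\varphi_1(x_1)\cdots\varphi_n(x_n)$. All Borel measures are regular. $\mathbb{E}_x(f)=\int_{\pi_1^{-1}(x)}f\,d\mathbb{P}_x$ is the conditional expectation of $f$ given $\pi_1=x$, and $\mathbb{E}_\bullet f$ denotes the function $x\mapsto\mathbb{E}_x(f)$. An operator $R$ on $C(B)$ is extended to Borel functions by $R(\varphi)(x)=\int_B\varphi\,d\mu_x$, where $\mu_x$ is the unique regular Borel measure on $B$ with $R(\varphi)(x)=\int_B\varphi\,d\mu_x$ for all $\varphi\in C(B)$. The identity in (b) is a pointwise identity for Borel representatives $f$ for which the integrals involved exist (in particular for all bounded Borel $f$). *)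

theory Defs
  imports "HOL-Probability.Probability"
begin

text \<open>
  Conventions. A sequence \<open>(x\<^sub>1, x\<^sub>2, \<dots>)\<close> over \<open>B\<close> is a function \<open>nat \<Rightarrow> 'b\<close>, indexed from \<open>0\<close>, so the
  mathematical coordinate \<open>x\<^sub>n\<close> is \<open>\<omega> (n - 1)\<close>; in particular \<open>\<pi>\<^sub>1 \<omega> = \<omega> 0\<close>. The sigma-algebra on
  sequences is \<open>borel\<close> of the product topology, which for non-metrizable \<open>B\<close> may be strictly larger
  than the product of the Borel sigma-algebras. For compact \<open>B\<close> every continuous real function is
  bounded, so \<open>C(B)\<close> is the type \<open>'b \<Rightarrow>\<^sub>C real\<close> of bounded continuous functions.
\<close>

definition regular_borel_measure :: "'a::topological_space measure \<Rightarrow> bool" where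
  "regular_borel_measure M \<longleftrightarrow>
     sets M = sets borel \<and>
     (\<forall>K. compact K \<longrightarrow> emeasure M K < \<infinity>) \<and>
     (\<forall>A\<in>sets borel. emeasure M A = (INF U\<in>{U. A \<subseteq> U \<and> open U}. emeasure M U)) \<and>
     (\<forall>A\<in>sets borel. emeasure M A = (SUP K\<in>{K. K \<subseteq> A \<and> compact K}. emeasure M K))"

definition proj1 :: "(nat \<Rightarrow> 'b) \<Rightarrow> 'b" where
  "proj1 \<omega> = \<omega> 0"

definition seq_shift :: "(nat \<Rightarrow> 'b) \<Rightarrow> (nat \<Rightarrow> 'b)" where
  "seq_shift \<omega> = (\<lambda>n. \<omega> (Suc n))"

definition fiber :: "'b \<Rightarrow> (nat \<Rightarrow> 'b) set" where
  "fiber x = proj1 -` {x}"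

text \<open>
  \<open>dS = \<integral> dP\<^sub>x d\<mu>(x)\<close> with \<open>\<mu> = S \<circ> \<pi>\<^sub>1\<inverse>\<close>. Measurability of \<open>x \<mapsto> P\<^sub>x(A)\<close> is part of the notion: it gives
  the integral its meaning and makes \<open>x \<mapsto> \<integral> f dP\<^sub>x\<close> a Borel function for each bounded Borel \<open>f\<close>.
\<close>

definition disintegration_proj1 ::
    "(nat \<Rightarrow> 'b::t2_space) measure \<Rightarrow> ('b \<Rightarrow> (nat \<Rightarrow> 'b) measure) \<Rightarrow> bool" where
  "disintegration_proj1 S P \<longleftrightarrow>
     (\<forall>x. prob_space (P x) \<and> regular_borel_measure (P x) \<and> emeasure (P x) (fiber x) = 1) \<and>
     (\<forall>A\<in>sets borel.
        (\<lambda>x. emeasure (P x) A) \<in> borel_measurable borel \<and>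
        emeasure S A = (\<integral>\<^sup>+x. emeasure (P x) A \<partial>(distr S borel proj1)))"

definition cond_exp_fiber ::
    "('b \<Rightarrow> (nat \<Rightarrow> 'b) measure) \<Rightarrow> 'b \<Rightarrow> ((nat \<Rightarrow> 'b) \<Rightarrow> real) \<Rightarrow> real" where
  "cond_exp_fiber P x f = (LINT \<omega>:fiber x|P x. f \<omega>)"

definition mult_op ::
    "('b::topological_space \<Rightarrow>\<^sub>C real) \<Rightarrow> ('b \<Rightarrow>\<^sub>C real) \<Rightarrow> ('b \<Rightarrow>\<^sub>C real)" where
  "mult_op \<phi> f = Bcontfun (\<lambda>x. apply_bcontfun \<phi> x * apply_bcontfun f x)"

lemma apply_mult_op [simp]:
  "apply_bcontfun (mult_op \<phi> f) x = apply_bcontfun \<phi> x * apply_bcontfun f x"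
proof -
  obtain b c where "\<And>x. norm (apply_bcontfun \<phi> x) \<le> b" "\<And>x. norm (apply_bcontfun f x) \<le> c"
    using bounded_apply_bcontfun[of \<phi>] bounded_apply_bcontfun[of f]
    by (auto simp: bounded_iff)
  then have "norm (apply_bcontfun \<phi> x * apply_bcontfun f x) \<le> b * c" for x
    by (metis norm_mult mult_mono norm_ge_zero order_trans)
  then have "bounded (range (\<lambda>x. apply_bcontfun \<phi> x * apply_bcontfun f x))"
    by (auto simp: bounded_iff)
  then have "(\<lambda>x. apply_bcontfun \<phi> x * apply_bcontfun f x) \<in> bcontfun"
    by (auto simp: bcontfun_def intro!: continuous_intros)
  then show ?thesis
    by (simp add: mult_op_def Bcontfun_inverse)
qed

definition positive_op :: "(('b::topological_space \<Rightarrow>\<^sub>C real) \<Rightarrow> ('b \<Rightarrow>\<^sub>C real)) \<Rightarrow> bool" where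
  "positive_op R \<longleftrightarrow>
     (\<forall>\<phi>. (\<forall>x. 0 \<le> apply_bcontfun \<phi> x) \<longrightarrow> (\<forall>x. 0 \<le> apply_bcontfun (R \<phi>) x))"

definition tensor :: "('b::topological_space \<Rightarrow>\<^sub>C real) list \<Rightarrow> (nat \<Rightarrow> 'b) \<Rightarrow> real" where
  "tensor \<phi>s \<omega> = (\<Prod>i<length \<phi>s. apply_bcontfun (\<phi>s ! i) (\<omega> i))"

text \<open>
  The function \<open>M\<^bsub>\<phi>\<^esub> R M\<^bsub>\<psi>\<^sub>1\<^esub> R \<dots> R M\<^bsub>\<psi>\<^sub>k\<^esub> 1\<close>, where \<open>\<psi>s = [\<psi>\<^sub>1, \<dots>, \<psi>\<^sub>k]\<close>.
\<close>

definition alternating_word ::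
    "(('b::topological_space \<Rightarrow>\<^sub>C real) \<Rightarrow> ('b \<Rightarrow>\<^sub>C real)) \<Rightarrow>
     ('b \<Rightarrow>\<^sub>C real) \<Rightarrow> ('b \<Rightarrow>\<^sub>C real) list \<Rightarrow> ('b \<Rightarrow>\<^sub>C real)" where
  "alternating_word R \<phi> \<psi>s =
     mult_op \<phi> (foldr (\<lambda>\<psi> g. R (mult_op \<psi> g)) \<psi>s (const_bcontfun 1))"

text \<open>
  For compact Hausdorff \<open>B\<close> and positive linear \<open>R\<close>, the description below determines a measure, by
  the Riesz representation theorem.
\<close>

definition repr_measure ::
    "(('b::topological_space \<Rightarrow>\<^sub>C real) \<Rightarrow> ('b \<Rightarrow>\<^sub>C real)) \<Rightarrow> 'b \<Rightarrow> 'b measure" where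
  "repr_measure R x =
     (THE M. regular_borel_measure M \<and>
             (\<forall>\<phi>. apply_bcontfun (R \<phi>) x = (LINT y|M. apply_bcontfun \<phi> y)))"

definition borel_extension ::
    "(('b::topological_space \<Rightarrow>\<^sub>C real) \<Rightarrow> ('b \<Rightarrow>\<^sub>C real)) \<Rightarrow> ('b \<Rightarrow> real) \<Rightarrow> ('b \<Rightarrow> real)" where
  "borel_extension R g x = (LINT y|repr_measure R x. g y)"

text \<open>
  All integrals occurring in the identity \<open>E\<^sub>x(f \<circ> \<sigma>) = R(E\<^sub>\<bullet> f)(x)\<close> exist; the inner one, \<open>E\<^sub>y f\<close>, is
  only needed for almost every \<open>y\<close> with respect to the measure representing \<open>R\<close> at \<open>x\<close>.
\<close>

definition integrals_exist ::
    "('b \<Rightarrow> (nat \<Rightarrow> 'b) measure) \<Rightarrow> (('b::topological_space \<Rightarrow>\<^sub>C real) \<Rightarrow> ('b \<Rightarrow>\<^sub>C real)) \<Rightarrow>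
     'b \<Rightarrow> ((nat \<Rightarrow> 'b) \<Rightarrow> real) \<Rightarrow> bool" where
  "integrals_exist P R x f \<longleftrightarrow>
     set_integrable (P x) (fiber x) (f \<circ> seq_shift) \<and>
     (AE y in repr_measure R x. set_integrable (P y) (fiber y) f) \<and>
     integrable (repr_measure R x) (\<lambda>y. cond_exp_fiber P y f)"

end

theory Submission
  imports Defs
begin

text \<open>
  The same operator \<open>R\<close> serves in (a) and (b). From (b) to (a), peel the first factor off a tensor with
  the shift identity and induct on the number of factors; the Riesz representation theorem on a compact
  Hausdorff space makes the extension of \<open>R\<close> to Borel functions agree with \<open>R\<close> on \<open>C(B)\<close>.

  From (a) to (b), sums of tensors are uniformly dense in \<open>C(B\<^sup>\<nat>)\<close> by Stone and Weierstrass. Hence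
  \<open>y \<mapsto> \<integral> g dP\<^sub>y\<close> is continuous for every continuous \<open>g\<close>, and \<open>\<integral> g \<circ> \<sigma> dP\<^sub>x = \<integral> (\<integral> g dP\<^sub>y) d\<mu>\<^sub>x(y)\<close> with
  \<open>\<mu>\<^sub>x\<close> the measure representing \<open>R\<close> at \<open>x\<close>. The indicator of an open set is the supremum of a directed, in
  general uncountable, family of continuous functions, and regular measures respect such suprema. So
  \<open>P\<^sub>x \<circ> \<sigma>\<inverse>\<close> and the mixture of the \<open>P\<^sub>y\<close> under \<open>\<mu>\<^sub>x\<close> agree on open sets, hence on Borel sets, and the
  identity passes to all \<open>f\<close> for which the integrals exist.
\<close>

section \<open>Compact Hausdorff spaces\<close>

text \<open>Up to \<open>t2_space\<close>, these instances make every lemma on compact Hausdorff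
  types available for sequences. Two distinct functions differ at some coordinate, and open sets
  separating the two values pull back along that coordinate.\<close>

instance "fun" :: (type, t0_space) t0_space
proof
  fix f g :: "'a \<Rightarrow> 'b"
  assume "f \<noteq> g"
  then obtain i where "f i \<noteq> g i" by auto
  then obtain U where U: "open U" "\<not> (f i \<in> U \<longleftrightarrow> g i \<in> U)"
    using t0_space_class.t0_space[OF \<open>f i \<noteq> g i\<close>] by auto
  have "open ((\<lambda>h::'a \<Rightarrow> 'b. h i) -` U)"
    using U(1) by (intro open_vimage continuous_on_product_coordinates)
  then show "\<exists>U. open U \<and> \<not> (f \<in> U \<longleftrightarrow> g \<in> U)"
    using U(2) by (intro exI[of _ "(\<lambda>h. h i) -` U"]) auto
qed

instance "fun" :: (type, t1_space) t1_space
proof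
  fix f g :: "'a \<Rightarrow> 'b"
  assume "f \<noteq> g"
  then obtain i where "f i \<noteq> g i" by auto
  then obtain U where U: "open U" "f i \<in> U" "g i \<notin> U"
    using t1_space_class.t1_space[OF \<open>f i \<noteq> g i\<close>] by auto
  have "open ((\<lambda>h::'a \<Rightarrow> 'b. h i) -` U)"
    using U(1) by (intro open_vimage continuous_on_product_coordinates)
  then show "\<exists>U. open U \<and> f \<in> U \<and> g \<notin> U"
    using U by (intro exI[of _ "(\<lambda>h. h i) -` U"]) auto
qed

instance "fun" :: (type, t2_space) t2_space
proof
  fix f g :: "'a \<Rightarrow> 'b"
  assume "f \<noteq> g"
  then obtain i where "f i \<noteq> g i" by auto
  then obtain U V where UV: "open U" "open V" "f i \<in> U" "g i \<in> V" "U \<inter> V = {}"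
    using hausdorff[OF \<open>f i \<noteq> g i\<close>] by auto
  have "continuous_on UNIV (\<lambda>h::'a \<Rightarrow> 'b. h i)"
    by (rule continuous_on_product_coordinates)
  then have "open ((\<lambda>h::'a \<Rightarrow> 'b. h i) -` U)" "open ((\<lambda>h::'a \<Rightarrow> 'b. h i) -` V)"
    using UV by (auto intro: open_vimage)
  then show "\<exists>U V. open U \<and> open V \<and> f \<in> U \<and> g \<in> V \<and> U \<inter> V = {}"
    using UV by (intro exI[of _ "(\<lambda>h. h i) -` U"] exI[of _ "(\<lambda>h. h i) -` V"]) auto
qed

text \<open>Tychonoff's theorem, carried over from \<open>product_topology\<close> to the type class
  topology on functions.\<close>

lemma compact_UNIV_fun:
  assumes "compact (UNIV :: 'b::topological_space set)"
  shows "compact (UNIV :: ('i \<Rightarrow> 'b) set)"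
proof -
  have "compact_space (product_topology (\<lambda>_::'i. euclidean :: 'b topology) UNIV)"
    by (rule compact_space_product_topology[THEN iffD2]) (simp add: assms compact_space_def)
  then show ?thesis
    by (simp add: euclidean_product_topology compact_space_def)
qed

lemma urysohn_compact_t2:
  assumes "compact (UNIV :: 'a::t2_space set)" "closed S" "closed T" "S \<inter> T = {}"
  obtains f :: "'a::t2_space \<Rightarrow> real"
  where "continuous_on UNIV f" "\<And>x. 0 \<le> f x" "\<And>x. f x \<le> 1"
    "\<And>x. x \<in> S \<Longrightarrow> f x = 0" "\<And>x. x \<in> T \<Longrightarrow> f x = 1"
proof -
  have "Hausdorff_space (euclidean :: 'a topology)"
    unfolding Hausdorff_space_def disjnt_def by simp (meson hausdorff)
  then have "normal_space (euclidean :: 'a topology)"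
    using assms(1) by (intro compact_Hausdorff_or_regular_imp_normal_space) (auto simp: compact_space_def)
  then obtain f where "continuous_map euclidean (top_of_set {0..1::real}) f" "f ` S \<subseteq> {0}" "f ` T \<subseteq> {1}"
    using Urysohn_lemma[of "euclidean :: 'a topology" S T 0 1] assms
    by (auto simp: disjnt_def)
  then have "continuous_on UNIV f" "range f \<subseteq> {0..1}" "f ` S \<subseteq> {0}" "f ` T \<subseteq> {1}"
    by (auto simp: continuous_map_in_subtopology)
  then show ?thesis
    using that[of f] by (auto simp: image_subset_iff)
qed

text \<open>Weaker than the customary relation of f to U, in which the closed support of f lies in
  U: here f merely vanishes off U. A compact carrier inside U is recovered where it matters, in
  \<open>content_approx\<close>.\<close>

definition subordinate :: "'a::topological_space set \<Rightarrow> ('a \<Rightarrow> real) set" where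
  "subordinate U = {f. continuous_on UNIV f \<and> (\<forall>x. 0 \<le> f x \<and> f x \<le> 1) \<and> (\<forall>x. x \<notin> U \<longrightarrow> f x = 0)}"

lemma subordinateD:
  assumes "f \<in> subordinate U"
  shows "continuous_on UNIV f" "0 \<le> f x" "f x \<le> 1" "f x \<le> indicator U x" "x \<notin> U \<Longrightarrow> f x = 0"
  using assms by (auto simp: subordinate_def indicator_def)

lemma zero_subordinate: "(\<lambda>_. 0) \<in> subordinate U"
  by (auto simp: subordinate_def)

lemma max_subordinate:
  assumes "f \<in> subordinate U" "g \<in> subordinate U"
  shows "(\<lambda>x. max (f x) (g x)) \<in> subordinate U"
proof -
  have "continuous_on UNIV (\<lambda>x. max (f x) (g x))"
    using assms by (intro continuous_on_max) (simp_all add: subordinate_def)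
  then show ?thesis
    using assms by (simp add: subordinate_def le_max_iff_disj)
qed

text \<open>The family is directed, so the finitely many functions of a subcover can be replaced by
  one.\<close>

lemma finite_subordinate_upper_bound:
  assumes "finite F" "F \<subseteq> subordinate U"
  shows "\<exists>g\<in>subordinate U. \<forall>f\<in>F. \<forall>x. f x \<le> g x"
  using assms
proof (induction F)
  case empty
  then show ?case using zero_subordinate by blast
next
  case (insert f F)
  then obtain g where "g \<in> subordinate U" "\<forall>f\<in>F. \<forall>x. f x \<le> g x" by auto
  then show ?case
    using insert.prems max_subordinate[of f U g]
    by (intro bexI[of _ "\<lambda>x. max (f x) (g x)"]) (auto simp: le_max_iff_disj)
qed

lemma urysohn_subordinate:
  assumes "compact (UNIV :: 'a::t2_space set)" "compact K" "open U" "K \<subseteq> U"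
  obtains f :: "'a::t2_space \<Rightarrow> real" where "f \<in> subordinate U" "\<And>x. x \<in> K \<Longrightarrow> f x = 1"
proof -
  have K: "closed (- U)" "closed K" "- U \<inter> K = {}"
    using assms compact_imp_closed by auto
  obtain f :: "'a \<Rightarrow> real" where "continuous_on UNIV f" "\<And>x. 0 \<le> f x" "\<And>x. f x \<le> 1"
    "\<And>x. x \<in> - U \<Longrightarrow> f x = 0" "\<And>x. x \<in> K \<Longrightarrow> f x = 1"
    using urysohn_compact_t2[OF assms(1) K] by blast
  then show ?thesis
    by (intro that[of f]) (auto simp: subordinate_def)
qed

text \<open>Levels \<open>t > k / n\<close> count to \<open>\<lceil>n t\<rceil>\<close> as long as \<open>t \<le> 1\<close>.\<close>

lemma layer_count:
  fixes t :: real
  assumes "0 \<le> t" "t \<le> 1" "0 < n"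
  shows "t \<le> (\<Sum>k<n. if real k / n < t then 1 else 0) / n"
    "(\<Sum>k<n. if real k / n < t then 1 else 0) / n \<le> t + 1 / n"
proof -
  define m where "m = nat \<lceil>n * t\<rceil>"
  have m: "real m < n * t + 1" "n * t \<le> real m" "m \<le> n"
  proof -
    have "real m = of_int \<lceil>n * t\<rceil>" using assms by (simp add: m_def)
    then show "real m < n * t + 1" "n * t \<le> real m" by linarith+
    have "n * t \<le> real n" using assms by (simp add: mult_left_le)
    then show "m \<le> n" by (simp add: m_def ceiling_le_iff nat_le_iff)
  qed
  have level: "real k / n < t \<longleftrightarrow> k < m" for k
  proof -
    have "real k / n < t \<longleftrightarrow> real k < n * t" using assms by (simp add: field_simps)
    also have "\<dots> \<longleftrightarrow> int k < \<lceil>n * t\<rceil>" by (simp add: less_ceiling_iff)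
    finally show ?thesis by (simp add: m_def zless_nat_eq_int_zless)
  qed
  have "(\<Sum>k<n. if real k / n < t then 1 else 0) = (\<Sum>k<n. if k < m then 1 else (0::real))"
    by (simp only: level)
  also have "\<dots> = (\<Sum>k<m. 1)"
    using m(3) by (intro sum.mono_neutral_cong_right) auto
  finally have *: "(\<Sum>k<n. if real k / n < t then 1 else (0::real)) = real m" by simp
  show "t \<le> (\<Sum>k<n. if real k / n < t then 1 else 0) / n"
    "(\<Sum>k<n. if real k / n < t then 1 else 0) / n \<le> t + 1 / n"
    unfolding * using m(1,2) assms(3) by (simp_all add: field_simps)
qed

section \<open>Regular Borel measures\<close>

lemma regular_borel_measureD:
  assumes "regular_borel_measure M"
  shows "sets M = sets borel" "space M = UNIV"
    "A \<in> sets borel \<Longrightarrow> emeasure M A = (SUP K\<in>{K. K \<subseteq> A \<and> compact K}. emeasure M K)"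
proof -
  show sets: "sets M = sets borel"
    using assms by (simp add: regular_borel_measure_def)
  show "space M = UNIV"
    using sets_eq_imp_space_eq[OF sets] by simp
  show "A \<in> sets borel \<Longrightarrow> emeasure M A = (SUP K\<in>{K. K \<subseteq> A \<and> compact K}. emeasure M K)"
    using assms unfolding regular_borel_measure_def by blast
qed

lemma finite_measure_regular_borel:
  assumes "compact (UNIV :: 'a::topological_space set)" "regular_borel_measure (M :: 'a measure)"
  shows "finite_measure M"
proof
  have "emeasure M UNIV < \<infinity>"
    using assms unfolding regular_borel_measure_def by blast
  then show "emeasure M (space M) \<noteq> \<infinity>"
    using regular_borel_measureD(2)[OF assms(2)] by simp
qed

lemma regular_borel_measure_inner:
  assumes "compact (UNIV :: 'a::t2_space set)" "regular_borel_measure (M :: 'a measure)"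
    and "A \<in> sets borel" "e > 0"
  obtains K where "compact K" "K \<subseteq> A" "measure M A - e < measure M K"
proof -
  interpret finite_measure M using assms by (simp add: finite_measure_regular_borel)
  show ?thesis
  \<comment> \<open>\<open>ennreal\<close> sends negative numbers to 0, so a negative bound is
    treated apart; the empty set meets it.\<close>
  proof (cases "measure M A - e < 0")
    case True
    then show ?thesis by (intro that[of "{}"]) auto
  next
    case False
    then have "ennreal (measure M A - e) < emeasure M A"
      using assms(4) by (simp add: emeasure_eq_measure ennreal_less_iff)
    also have "emeasure M A = (SUP K\<in>{K. K \<subseteq> A \<and> compact K}. emeasure M K)"
      using assms by (intro regular_borel_measureD)
    finally obtain K where "K \<subseteq> A" "compact K" "ennreal (measure M A - e) < emeasure M K"
      by (auto simp: less_SUP_iff)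
    then show ?thesis
      using False by (intro that) (auto simp: emeasure_eq_measure ennreal_less_iff)
  qed
qed

text \<open>An open set around the complement of A, of nearly the same measure, has a complement
  that is closed, hence compact, and lies in A. So outer regularity of a finite measure on a compact
  space yields inner regularity.\<close>

lemma regular_borel_measureI_outer:
  fixes M :: "'a::t2_space measure"
  assumes comp: "compact (UNIV :: 'a set)" and "finite_measure M" and sets: "sets M = sets borel"
    and outer: "\<And>A e. A \<in> sets borel \<Longrightarrow> 0 < e \<Longrightarrow>
      \<exists>U. open U \<and> A \<subseteq> U \<and> measure M U \<le> measure M A + e"
  shows "regular_borel_measure M"
proof -
  interpret finite_measure M by fact
  have space: "space M = UNIV"
    using sets_eq_imp_space_eq[OF sets] by simp
  have [measurable]: "open U \<Longrightarrow> U \<in> sets M" "compact U \<Longrightarrow> U \<in> sets M" for U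
    by (auto simp: sets compact_imp_closed)
  have "emeasure M A = (INF U\<in>{U. A \<subseteq> U \<and> open U}. emeasure M U)" if A: "A \<in> sets borel" for A
  proof (rule antisym)
    show "emeasure M A \<le> (INF U\<in>{U. A \<subseteq> U \<and> open U}. emeasure M U)"
      by (auto intro!: INF_greatest emeasure_mono)
    show "(INF U\<in>{U. A \<subseteq> U \<and> open U}. emeasure M U) \<le> emeasure M A"
    proof (rule ennreal_le_epsilon)
      fix e :: real assume "0 < e"
      then obtain U where U: "open U" "A \<subseteq> U" "measure M U \<le> measure M A + e"
        using outer[OF A] by blast
      then have "(INF U\<in>{U. A \<subseteq> U \<and> open U}. emeasure M U) \<le> emeasure M U"
        by (intro INF_lower) auto
      also have "\<dots> \<le> emeasure M A + ennreal e"
        using U(3) \<open>0 < e\<close> by (simp add: emeasure_eq_measure flip: ennreal_plus)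
      finally show "(INF U\<in>{U. A \<subseteq> U \<and> open U}. emeasure M U) \<le> emeasure M A + ennreal e" .
    qed
  qed
  moreover have "emeasure M A = (SUP K\<in>{K. K \<subseteq> A \<and> compact K}. emeasure M K)"
    if A: "A \<in> sets borel" for A
  proof (rule antisym)
    show "(SUP K\<in>{K. K \<subseteq> A \<and> compact K}. emeasure M K) \<le> emeasure M A"
      using A sets by (auto intro!: SUP_least emeasure_mono)
    show "emeasure M A \<le> (SUP K\<in>{K. K \<subseteq> A \<and> compact K}. emeasure M K)"
    proof (rule ennreal_le_epsilon)
      fix e :: real assume "0 < e"
      have A': "- A \<in> sets borel" using A by (simp add: borel_comp)
      obtain U where U: "open U" "- A \<subseteq> U" "measure M U \<le> measure M (- A) + e"
        using outer[OF A' \<open>0 < e\<close>] by blast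
      have K: "- U \<subseteq> A" "compact (- U)"
        using U compact_Int_closed[OF comp, of "- U"] by auto
      have "measure M A \<le> measure M (- U) + e"
        using U(3) finite_measure_compl[of A] finite_measure_compl[of U] A \<open>open U\<close>
        by (simp add: sets space Compl_eq_Diff_UNIV)
      then have "emeasure M A \<le> emeasure M (- U) + ennreal e"
        using \<open>0 < e\<close> by (simp add: emeasure_eq_measure flip: ennreal_plus)
      also have "emeasure M (- U) \<le> (SUP K\<in>{K. K \<subseteq> A \<and> compact K}. emeasure M K)"
        using K by (intro SUP_upper) auto
      finally show "emeasure M A \<le> (SUP K\<in>{K. K \<subseteq> A \<and> compact K}. emeasure M K) + ennreal e"
        by (simp add: add_right_mono)
    qed
  qed
  moreover have "emeasure M K < \<infinity>" for K
    by (simp add: emeasure_eq_measure)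
  ultimately show ?thesis
    unfolding regular_borel_measure_def using sets by blast
qed

text \<open>Compact sets are transported by direct images: a compact K filling most of the preimage
  of \<open>- A\<close> has a compact image that misses A, and the complement of this image is the
  open set required around A.\<close>

lemma regular_borel_measure_distr:
  fixes h :: "'a::t2_space \<Rightarrow> 'c::t2_space"
  assumes "compact (UNIV :: 'a set)" "compact (UNIV :: 'c set)"
    and M: "regular_borel_measure M" and h: "continuous_on UNIV h"
  shows "regular_borel_measure (distr M borel h)"
proof (rule regular_borel_measureI_outer)
  interpret finite_measure M using assms by (simp add: finite_measure_regular_borel)
  note D = regular_borel_measureD[OF M]
  have h_meas [measurable]: "h \<in> measurable M borel"
    using borel_measurable_continuous_onI[OF h] D(1) by (simp cong: measurable_cong_sets)
  show "finite_measure (distr M borel h)"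
    by (rule finite_measure_distr) measurable
  fix A :: "'c set" and e :: real assume A: "A \<in> sets borel" "0 < e"
  have A': "- A \<in> sets borel" using A by (simp add: borel_comp)
  have vim: "h -` B \<in> sets M" if "B \<in> sets borel" for B
    using measurable_sets[OF h_meas that] D(2) by simp
  obtain K where K: "compact K" "K \<subseteq> h -` (- A)" "measure M (h -` (- A)) - e < measure M K"
    using regular_borel_measure_inner[OF assms(1) M, of "h -` (- A)" e] vim[OF A'] A(2) D(1) by metis
  have hK: "compact (h ` K)"
    using K h by (intro compact_continuous_image) (auto intro: continuous_on_subset)
  have K_sets: "K \<in> sets M" using K(1) D(1) by (simp add: compact_imp_closed)
  have "open (- (h ` K))" using hK compact_imp_closed by blast
  moreover have "A \<subseteq> - (h ` K)" using K(2) by auto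
  moreover have "measure (distr M borel h) (- (h ` K)) \<le> measure (distr M borel h) A + e"
  proof -
    have "measure (distr M borel h) (- (h ` K)) = measure M (h -` (- (h ` K)))"
      using \<open>open (- (h ` K))\<close> by (subst measure_distr) (auto simp: D)
    also have "\<dots> \<le> measure M (- K)"
      using K_sets sets.compl_sets[OF K_sets] by (intro finite_measure_mono) (auto simp: D Compl_eq_Diff_UNIV)
    also have "\<dots> = measure M UNIV - measure M K"
      using finite_measure_compl[OF K_sets] by (simp add: D Compl_eq_Diff_UNIV)
    also have "\<dots> \<le> measure M UNIV - measure M (h -` (- A)) + e"
      using K(3) by simp
    also have "measure M UNIV - measure M (h -` (- A)) = measure M (h -` A)"
      using finite_measure_compl[OF vim[OF A(1)]] by (simp add: D vimage_Diff Compl_eq_Diff_UNIV)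
    also have "\<dots> = measure (distr M borel h) A"
      using A by (subst measure_distr) (auto simp: D)
    finally show ?thesis by simp
  qed
  ultimately show "\<exists>U. open U \<and> A \<subseteq> U \<and> measure (distr M borel h) U \<le> measure (distr M borel h) A + e"
    by blast
qed (use assms in auto)

section \<open>Integrals of continuous functions and uniqueness of measures\<close>

lemma integrable_continuous_compact:
  fixes f :: "'a::topological_space \<Rightarrow> real"
  assumes "compact (UNIV :: 'a set)" "finite_measure M" "sets M = sets borel" "continuous_on UNIV f"
  shows "integrable M f"
proof -
  interpret finite_measure M by fact
  have "bounded (range f)"
    using compact_continuous_image[OF assms(4,1)] by (rule compact_imp_bounded)
  then obtain C where "\<And>x. norm (f x) \<le> C" by (auto simp: bounded_iff)
  moreover have "f \<in> borel_measurable M"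
    using borel_measurable_continuous_onI[OF assms(4)] assms(3) by (simp cong: measurable_cong_sets)
  ultimately show ?thesis by (intro integrable_const_bound[of _ C]) auto
qed

lemma integral_subordinate_le:
  fixes f :: "'a::topological_space \<Rightarrow> real"
  assumes "compact (UNIV :: 'a set)" "finite_measure M" "sets M = sets borel" "open U" "f \<in> subordinate U"
  shows "(LINT x|M. f x) \<le> measure M U"
proof -
  interpret finite_measure M by fact
  have "U \<in> sets M" using assms by simp
  moreover have "integrable M f"
    using assms by (intro integrable_continuous_compact subordinateD)
  ultimately have "(LINT x|M. f x) \<le> (LINT x|M. indicator U x)"
    using assms(5) by (intro integral_mono) (auto simp: subordinateD emeasure_eq_measure)
  then show ?thesis
    using \<open>U \<in> sets M\<close> sets.sets_into_space[of U M] by (simp add: Int_absorb2)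
qed

text \<open>A Urysohn function that is 1 on a compact set filling most of U does it. With
  \<open>integral_subordinate_le\<close>, the measure of an open set is the supremum of the
  integrals of the functions subordinate to it.\<close>

lemma regular_borel_measure_subordinate:
  fixes M :: "'a::t2_space measure"
  assumes "compact (UNIV :: 'a set)" "regular_borel_measure M" "open U" "e > 0"
  obtains f where "f \<in> subordinate U" "measure M U - e < (LINT x|M. f x)"
proof -
  note D = regular_borel_measureD[OF assms(2)]
  interpret finite_measure M using assms by (simp add: finite_measure_regular_borel)
  obtain K where K: "compact K" "K \<subseteq> U" "measure M U - e < measure M K"
    using regular_borel_measure_inner[OF assms(1,2) _ assms(4), of U] assms(3) by auto
  obtain f where f: "f \<in> subordinate U" "\<And>x. x \<in> K \<Longrightarrow> f x = 1"
    using urysohn_subordinate[OF assms(1) K(1) assms(3) K(2)] by blast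
  have K_sets: "K \<in> sets M" using K(1) D(1) by (simp add: compact_imp_closed)
  moreover have "integrable M f"
    using f(1) assms(1) D(1) finite_measure_axioms
    by (intro integrable_continuous_compact subordinateD)
  ultimately have "(LINT x|M. indicator K x) \<le> (LINT x|M. f x)"
    using f by (intro integral_mono) (auto simp: subordinateD emeasure_eq_measure split: split_indicator)
  then have "measure M K \<le> (LINT x|M. f x)"
    using K_sets by (simp add: D)
  then show ?thesis using that[OF f(1)] K(3) by simp
qed

text \<open>Open sets form an intersection-stable generator that contains the whole space. The lemma
  also serves for a mixture \<open>M \<bind> K\<close>, of which only the values on open sets are at
  hand.\<close>

lemma borel_measure_eqI_open:
  fixes M N :: "'a::topological_space measure"
  assumes "finite_measure M" "finite_measure N" and sets: "sets M = sets borel" "sets N = sets borel"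
    and eq: "\<And>U. open U \<Longrightarrow> measure M U = measure N U"
  shows "M = N"
proof (rule measure_eqI_generator_eq[where E = "{U. open U}" and \<Omega> = UNIV and A = "\<lambda>_. UNIV"])
  interpret M: finite_measure M by fact
  interpret N: finite_measure N by fact
  show "emeasure M X = emeasure N X" if "X \<in> {U. open U}" for X
    using eq that by (simp add: M.emeasure_eq_measure N.emeasure_eq_measure)
  show "emeasure M UNIV \<noteq> \<infinity>" by (simp add: M.emeasure_eq_measure)
qed (auto simp: sets Int_stable_def sets_borel)

text \<open>The uniqueness half of the Riesz theorem: integrals of subordinate functions determine a
  regular measure on open sets.\<close>

lemma regular_borel_measure_eqI:
  fixes M N :: "'a::t2_space measure"
  assumes comp: "compact (UNIV :: 'a set)" and M: "regular_borel_measure M" and N: "regular_borel_measure N"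
    and eq: "\<And>f :: 'a \<Rightarrow> real. continuous_on UNIV f \<Longrightarrow> (LINT x|M. f x) = (LINT x|N. f x)"
  shows "M = N"
proof -
  \<comment> \<open>Stated for fresh M and N, so that it can be used again with the roles
    exchanged.\<close>
  have le: "measure M U \<le> measure N U"
    if M: "regular_borel_measure M" and N: "regular_borel_measure N" and U: "open U"
      and eq: "\<And>f :: 'a \<Rightarrow> real. continuous_on UNIV f \<Longrightarrow> (LINT x|M. f x) = (LINT x|N. f x)"
    for M N :: "'a measure" and U
  proof (rule field_le_epsilon)
    fix e :: real assume "0 < e"
    then obtain f where f: "f \<in> subordinate U" "measure M U - e < (LINT x|M. f x)"
      using regular_borel_measure_subordinate[OF comp M U] by blast
    then show "measure M U \<le> measure N U + e"
      using integral_subordinate_le[OF comp finite_measure_regular_borel[OF comp N] _ U f(1)]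
        regular_borel_measureD(1)[OF N] eq[of f] subordinateD(1)[OF f(1)] by simp
  qed
  show ?thesis
    using assms le[OF M N] le[OF N M]
    by (intro borel_measure_eqI_open finite_measure_regular_borel antisym)
       (auto simp: regular_borel_measureD)
qed

section \<open>The Riesz representation theorem\<close>

text \<open>The axioms speak of continuous arguments only. This admits functionals built with
  \<open>Bcontfun\<close>, whose value is unspecified on functions that are not bounded and
  continuous.\<close>

locale state_functional =
  fixes L :: "('a::t2_space \<Rightarrow> real) \<Rightarrow> real"
  assumes compact_space: "compact (UNIV :: 'a set)"
    and add: "\<And>f g. continuous_on UNIV f \<Longrightarrow> continuous_on UNIV g \<Longrightarrow> L (\<lambda>x. f x + g x) = L f + L g"
    and scale: "\<And>c f. continuous_on UNIV f \<Longrightarrow> L (\<lambda>x. c * f x) = c * L f"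
    and nonneg: "\<And>f. continuous_on UNIV f \<Longrightarrow> (\<And>x. 0 \<le> f x) \<Longrightarrow> 0 \<le> L f"
    and one: "L (\<lambda>_. 1) = 1"
begin

lemma diff:
  assumes "continuous_on UNIV f" "continuous_on UNIV g"
  shows "L (\<lambda>x. f x - g x) = L f - L g"
  using add[of f "\<lambda>x. -1 * g x"] scale[of g "-1"] assms by (simp add: continuous_on_minus)

lemma mono:
  assumes "continuous_on UNIV f" "continuous_on UNIV g" "\<And>x. f x \<le> g x"
  shows "L f \<le> L g"
  using nonneg[of "\<lambda>x. g x - f x"] diff[of g f] assms by (simp add: continuous_on_diff)

lemma const: "L (\<lambda>_. c) = c"
  using scale[of "\<lambda>_. 1" c] one by simp

lemma sum:
  assumes "finite I" "\<And>i. i \<in> I \<Longrightarrow> continuous_on UNIV (f i)"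
  shows "L (\<lambda>x. \<Sum>i\<in>I. f i x) = (\<Sum>i\<in>I. L (f i))"
  using assms
proof (induction I)
  case empty
  then show ?case using const[of 0] by simp
next
  case (insert i I)
  then show ?case
    using add[of "f i" "\<lambda>x. \<Sum>i\<in>I. f i x"] by (simp add: continuous_on_sum)
qed

section \<open>The content of open sets and its subadditivity\<close>

definition content :: "'a set \<Rightarrow> real" where
  "content U = (SUP f\<in>subordinate U. L f)"

lemma subordinate_bounds:
  assumes "f \<in> subordinate U"
  shows "0 \<le> L f" "L f \<le> 1"
  using nonneg[of f] mono[of f "\<lambda>_. 1"] one subordinateD[OF assms] by auto

lemma content_upper: "f \<in> subordinate U \<Longrightarrow> L f \<le> content U"
  unfolding content_def
  by (rule cSUP_upper) (auto simp: bdd_above_def intro: subordinate_bounds)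

lemma content_least: "(\<And>f. f \<in> subordinate U \<Longrightarrow> L f \<le> c) \<Longrightarrow> content U \<le> c"
  unfolding content_def using zero_subordinate by (intro cSUP_least) auto

lemma content_nonneg [simp]: "0 \<le> content U"
  using content_upper[OF zero_subordinate] const[of 0] by simp

lemma content_mono: "U \<subseteq> V \<Longrightarrow> content U \<le> content V"
  by (intro content_least content_upper) (auto simp: subordinate_def)

lemma content_empty: "content {} = 0"
proof (rule antisym)
  show "content {} \<le> 0"
  proof (rule content_least)
    fix f :: "'a \<Rightarrow> real" assume "f \<in> subordinate {}"
    then have "f = (\<lambda>_. 0)" by (auto simp: subordinate_def)
    then show "L f \<le> 0" using const[of 0] by simp
  qed
qed simp

lemma content_UNIV: "content UNIV = 1"
proof (rule antisym)
  show "content UNIV \<le> 1" by (intro content_least subordinate_bounds)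
  show "1 \<le> content UNIV"
    using content_upper[of "\<lambda>_. 1" UNIV] one by (simp add: subordinate_def)
qed

text \<open>Cutting off at height \<open>e\<close> makes the support compact at the cost of \<open>e\<close>.\<close>

lemma content_approx:
  assumes "open U" "e > 0"
  obtains f K where "f \<in> subordinate U" "compact K" "K \<subseteq> U" "\<And>x. x \<notin> K \<Longrightarrow> f x = 0" "content U - e < L f"
proof -
  have "\<exists>f\<in>subordinate U. content U - e / 2 < L f"
  proof (rule ccontr)
    assume "\<not> ?thesis"
    then have "content U \<le> content U - e / 2"
      by (intro content_least) (simp add: not_less)
    then show False using assms by simp
  qed
  then obtain f where f: "f \<in> subordinate U" "content U - e / 2 < L f" by blast
  note D = subordinateD[OF f(1)]
  define g where "g x = max (f x - e / 2) 0" for x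
  define K where "K = {x. e / 2 \<le> f x}"
  have cont: "continuous_on UNIV g"
    unfolding g_def by (intro continuous_intros D)
  have "closed K"
    unfolding K_def by (intro closed_Collect_le continuous_intros D)
  then have "compact K"
    using compact_Int_closed[OF compact_space] by (metis inf_top_left)
  moreover have "K \<subseteq> U" using D(5) \<open>e > 0\<close> by (force simp: K_def)
  moreover have "g x = 0" if "x \<notin> K" for x using that by (simp add: K_def g_def)
  moreover have "0 \<le> g x \<and> g x \<le> 1 \<and> (x \<notin> U \<longrightarrow> g x = 0)" for x
    using D(3)[of x] D(5)[of x] \<open>e > 0\<close> by (auto simp: g_def max_def)
  then have "g \<in> subordinate U"
    using cont by (simp add: subordinate_def)
  moreover have "L f \<le> L (\<lambda>x. g x + e / 2)"
    using cont D by (intro mono continuous_intros) (auto simp: g_def)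
  then have "content U - e < L g"
    using add[OF cont, of "\<lambda>_. e / 2"] const[of "e / 2"] f(2) by simp
  ultimately show ?thesis by (intro that)
qed

text \<open>If \<open>f\<close> vanishes off a compact \<open>K\<close> inside \<open>U \<union> V\<close>, an Urysohn function for
  \<open>K - V\<close> and \<open>- U\<close> splits \<open>f\<close> into a part carried by \<open>U\<close> and a part carried by \<open>V\<close>.\<close>

lemma content_Un:
  assumes "open U" "open V"
  shows "content (U \<union> V) \<le> content U + content V"
proof (rule field_le_epsilon)
  fix e :: real assume "0 < e"
  then obtain f K where f: "f \<in> subordinate (U \<union> V)" "compact K" "K \<subseteq> U \<union> V"
    "\<And>x. x \<notin> K \<Longrightarrow> f x = 0" "content (U \<union> V) - e < L f"
    using content_approx[of "U \<union> V" e] assms by blast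
  note D = subordinateD[OF f(1)]
  have "compact (K - V)" using f(2) assms by (simp add: compact_diff)
  then obtain g where g: "g \<in> subordinate U" "\<And>x. x \<in> K - V \<Longrightarrow> g x = 1"
    using urysohn_subordinate[OF compact_space, of "K - V" U] assms f(3) by blast
  note G = subordinateD[OF g(1)]
  have cont: "continuous_on UNIV (\<lambda>x. f x * g x)" "continuous_on UNIV (\<lambda>x. f x * (1 - g x))"
    by (intro continuous_intros D G)+
  have "(\<lambda>x. f x * g x) \<in> subordinate U"
    using D G cont by (auto simp: subordinate_def mult_le_one)
  moreover have "f x * (1 - g x) = 0" if "x \<notin> V" for x
    using g(2)[of x] f(4)[of x] that by (cases "x \<in> K") auto
  then have "(\<lambda>x. f x * (1 - g x)) \<in> subordinate V"
    using D G cont by (auto simp: subordinate_def mult_le_one)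
  moreover have "L f = L (\<lambda>x. f x * g x) + L (\<lambda>x. f x * (1 - g x))"
    using add[OF cont] by (simp add: algebra_simps)
  ultimately show "content (U \<union> V) \<le> content U + content V + e"
    using f(5) content_upper[of "\<lambda>x. f x * g x" U] content_upper[of "\<lambda>x. f x * (1 - g x)" V] by simp
qed

lemma content_UN_finite:
  assumes "\<And>i. open (U i)"
  shows "content (\<Union>i<n. U i) \<le> (\<Sum>i<(n::nat). content (U i))"
proof (induction n)
  case 0
  then show ?case by (simp add: content_empty)
next
  case (Suc n)
  have "content (U n \<union> (\<Union>i<n. U i)) \<le> content (U n) + content (\<Union>i<n. U i)"
    using assms by (intro content_Un) auto
  then show ?case using Suc by (simp add: lessThan_Suc)
qed

text \<open>A nearly optimal f is carried by a compact K, and finitely many of the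
  \<open>U i\<close> already cover K; so f is subordinate to a finite union.\<close>

lemma content_UN:
  fixes U :: "nat \<Rightarrow> 'a set"
  assumes "\<And>i. open (U i)"
  shows "ennreal (content (\<Union>i. U i)) \<le> (\<Sum>i. ennreal (content (U i)))"
proof (rule ennreal_le_epsilon)
  fix e :: real assume "0 < e"
  then obtain f K where f: "f \<in> subordinate (\<Union>i. U i)" "compact K" "K \<subseteq> (\<Union>i. U i)"
    "\<And>x. x \<notin> K \<Longrightarrow> f x = 0" "content (\<Union>i. U i) - e < L f"
    using content_approx[of "\<Union>i. U i" e] assms by blast
  obtain I where I: "finite I" "K \<subseteq> (\<Union>i\<in>I. U i)"
    using compactE_image[OF f(2), of UNIV U] assms f(3) by auto
  then obtain n where "I \<subseteq> {..<n}" using finite_nat_iff_bounded by auto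
  then have "K \<subseteq> (\<Union>i<n. U i)" using I by blast
  then have "f x = 0" if "x \<notin> (\<Union>i<n. U i)" for x
    using f(4) that by blast
  then have "f \<in> subordinate (\<Union>i<n. U i)"
    using f(1) by (simp add: subordinate_def)
  then have "L f \<le> (\<Sum>i<n. content (U i))"
    using content_upper content_UN_finite[of U n] assms by (meson order_trans)
  then have "ennreal (content (\<Union>i. U i)) \<le> ennreal ((\<Sum>i<n. content (U i)) + e)"
    using f(5) by (intro ennreal_leI) simp
  also have "\<dots> = (\<Sum>i<n. ennreal (content (U i))) + ennreal e"
    using \<open>0 < e\<close> by (simp add: ennreal_plus sum_nonneg)
  also have "\<dots> \<le> (\<Sum>i. ennreal (content (U i))) + ennreal e"
    by (intro add_right_mono sum_le_suminf) auto
  finally show "ennreal (content (\<Union>i. U i)) \<le> (\<Sum>i. ennreal (content (U i))) + ennreal e" .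
qed

section \<open>The outer measure and measurability of open sets\<close>

definition outer :: "'a set \<Rightarrow> ennreal" where
  "outer A = (INF U\<in>{U. open U \<and> A \<subseteq> U}. ennreal (content U))"

lemma outer_open: "open U \<Longrightarrow> outer U = ennreal (content U)"
  unfolding outer_def
  by (rule antisym) (auto intro!: INF_lower INF_greatest ennreal_leI content_mono)

lemma outer_le: "open U \<Longrightarrow> A \<subseteq> U \<Longrightarrow> outer A \<le> ennreal (content U)"
  unfolding outer_def by (intro INF_lower) auto

lemma outer_mono: "A \<subseteq> B \<Longrightarrow> outer A \<le> outer B"
  unfolding outer_def by (intro INF_superset_mono) auto

lemma outer_close:
  assumes "outer A < c"
  obtains U where "open U" "A \<subseteq> U" "ennreal (content U) < c"
  using assms by (auto simp: outer_def INF_less_iff)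

lemma outer_finite: "outer A \<noteq> \<infinity>"
proof -
  have "outer A \<le> ennreal 1"
    using outer_le[of UNIV A] content_UNIV by simp
  then show ?thesis by (auto simp: top_unique)
qed

lemma outer_measure_space_outer: "outer_measure_space (Pow UNIV) outer"
  unfolding outer_measure_space_def
proof (intro conjI)
  show "positive (Pow UNIV) outer"
    using outer_open[of "{}"] by (simp add: positive_def content_empty)
  show "increasing (Pow UNIV) outer"
    by (simp add: increasing_def outer_mono)
  show "countably_subadditive (Pow UNIV) outer"
    unfolding countably_subadditive_def
  proof (intro allI impI ballI)
    fix A :: "nat \<Rightarrow> 'a set"
    show "outer (\<Union>i. A i) \<le> (\<Sum>i. outer (A i))"
    proof (rule ennreal_le_epsilon)
      fix e :: real assume "0 < e"
      \<comment> \<open>The allowances \<open>e * (1/2)^Suc n\<close>, summed over n from 0, amount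
        to e.\<close>
      have "\<exists>U. open U \<and> A n \<subseteq> U \<and> ennreal (content U) \<le> outer (A n) + e * (1/2)^Suc n" for n
      proof -
        have "outer (A n) < outer (A n) + ennreal (e * (1/2)^Suc n)"
          using outer_finite[of "A n"] \<open>0 < e\<close> by (simp add: less_top)
        then show ?thesis by (rule outer_close) (auto intro: less_imp_le)
      qed
      then obtain U where U: "\<And>n. open (U n)" "\<And>n. A n \<subseteq> U n"
        "\<And>n. ennreal (content (U n)) \<le> outer (A n) + e * (1/2)^Suc n"
        by metis
      have "outer (\<Union>i. A i) \<le> ennreal (content (\<Union>i. U i))"
        using U(1,2) by (intro outer_le open_UN UN_mono) auto
      also have "\<dots> \<le> (\<Sum>i. ennreal (content (U i)))"
        using U(1) by (rule content_UN)
      also have "\<dots> \<le> (\<Sum>n. outer (A n) + e * (1/2) ^ Suc n)"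
        by (intro suminf_le allI U) auto
      also have "\<dots> = (\<Sum>n. outer (A n)) + (\<Sum>n. ennreal e * ennreal ((1/2) ^ Suc n))"
        using \<open>0 < e\<close> by (subst suminf_add[symmetric])
          (auto simp del: ennreal_suminf_cmult simp add: ennreal_mult[symmetric])
      also have "\<dots> = (\<Sum>n. outer (A n)) + e"
        unfolding ennreal_suminf_cmult
        by (subst suminf_ennreal_eq[OF zero_le_power power_half_series]) auto
      finally show "outer (\<Union>i. A i) \<le> (\<Sum>n. outer (A n)) + e" .
    qed
  qed
qed

text \<open>Inside an open V around A, choose nearly optimal functions f for
  \<open>V \<inter> U\<close> and g for V minus the compact carrier K of f. They are never nonzero
  at the same point, so \<open>f + g\<close> is subordinate to V and the two contents add up to at
  most that of V. The choices of V, f and g cost e / 3 each.\<close>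

lemma open_in_lambda_system:
  assumes "open U"
  shows "U \<in> lambda_system UNIV (Pow UNIV) outer"
proof -
  have "outer (A \<inter> U) + outer (A - U) \<le> outer A" for A
  proof (rule ennreal_le_epsilon)
    fix e :: real assume "0 < e"
    then have "outer A < outer A + ennreal (e / 3)"
      using outer_finite[of A] by (simp add: less_top)
    then obtain V where V: "open V" "A \<subseteq> V" "ennreal (content V) < outer A + ennreal (e / 3)"
      by (rule outer_close)
    obtain f K where f: "f \<in> subordinate (V \<inter> U)" "compact K" "K \<subseteq> V \<inter> U"
      "\<And>x. x \<notin> K \<Longrightarrow> f x = 0" "content (V \<inter> U) - e / 3 < L f"
      using content_approx[of "V \<inter> U" "e / 3"] V(1) assms \<open>0 < e\<close> by auto
    \<comment> \<open>\<open>V - U\<close> need not be open. Removing only K gives an open set that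
      still contains \<open>A - U\<close>.\<close>
    have W: "open (V - K)" using V(1) f(2) compact_imp_closed open_Diff by blast
    obtain g H where g: "g \<in> subordinate (V - K)" "compact H" "H \<subseteq> V - K"
      "\<And>x. x \<notin> H \<Longrightarrow> g x = 0" "content (V - K) - e / 3 < L g"
      using content_approx[OF W, of "e / 3"] \<open>0 < e\<close> by auto
    note D = subordinateD[OF f(1)] and G = subordinateD[OF g(1)]
    have "f x + g x \<le> 1" for x
      using f(4)[of x] G(5)[of x] D(3)[of x] G(3)[of x] by (cases "x \<in> K") auto
    then have "(\<lambda>x. f x + g x) \<in> subordinate V"
      using D G by (auto simp: subordinate_def continuous_on_add)
    then have "L f + L g \<le> content V"
      using content_upper add[OF D(1) G(1)] by metis
    then have le: "content (V \<inter> U) + content (V - K) \<le> content V + 2 * e / 3"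
      using f(5) g(5) by simp
    have "outer (A \<inter> U) + outer (A - U) \<le> ennreal (content (V \<inter> U)) + ennreal (content (V - K))"
      using V f(3) assms W by (intro add_mono outer_le) auto
    also have "\<dots> = ennreal (content (V \<inter> U) + content (V - K))"
      by (simp add: ennreal_plus)
    also have "\<dots> \<le> ennreal (content V + 2 * e / 3)"
      using le by (rule ennreal_leI)
    also have "\<dots> = ennreal (content V) + ennreal (2 * e / 3)"
      using \<open>0 < e\<close> by (simp add: ennreal_plus)
    also have "\<dots> \<le> outer A + ennreal (e / 3) + ennreal (2 * e / 3)"
      using V(3) by (intro add_right_mono) simp
    also have "\<dots> = outer A + ennreal e"
      using \<open>0 < e\<close> by (simp add: add.assoc flip: ennreal_plus)
    finally show "outer (A \<inter> U) + outer (A - U) \<le> outer A + ennreal e" .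
  qed
  moreover have "outer A \<le> outer (A \<inter> U) + outer (A - U)" for A
  proof -
    have "subadditive (Pow UNIV) outer"
      using outer_measure_space_outer ring_of_sets.countably_subadditive_subadditive[OF sigma_algebra.axioms(1)[OF sigma_algebra_Pow, THEN algebra.axioms(1)]]
      unfolding outer_measure_space_def by blast
    then have "outer ((A \<inter> U) \<union> (A - U)) \<le> outer (A \<inter> U) + outer (A - U)"
      by (intro subadditiveD) auto
    then show ?thesis by (simp add: Int_Diff_Un)
  qed
  ultimately show ?thesis
    unfolding lambda_system_def by (auto simp: Int_commute Diff_eq intro!: antisym)
qed

section \<open>The representing measure and its integrals\<close>

definition riesz_measure :: "'a measure" where
  "riesz_measure = measure_of UNIV (sets borel) outer"

lemma sets_riesz_measure [simp]: "sets riesz_measure = sets borel"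
  unfolding riesz_measure_def using sets.sigma_sets_eq[of "borel :: 'a measure"] by simp

lemma space_riesz_measure [simp]: "space riesz_measure = UNIV"
  unfolding riesz_measure_def by (simp add: space_measure_of_conv)

text \<open>By Caratheodory's lemma \<open>outer\<close> is a measure on the lambda system, a
  sigma-algebra that contains the open sets and therefore all Borel sets.\<close>

lemma emeasure_riesz_measure:
  assumes "A \<in> sets borel"
  shows "emeasure riesz_measure A = outer A"
proof -
  let ?\<Lambda> = "lambda_system UNIV (Pow UNIV) outer"
  have ms: "measure_space UNIV ?\<Lambda> outer"
    using sigma_algebra.caratheodory_lemma[OF sigma_algebra_Pow outer_measure_space_outer] .
  then interpret \<Lambda>: sigma_algebra UNIV ?\<Lambda> by (simp add: measure_space_def)
  have "sets (borel :: 'a measure) \<subseteq> ?\<Lambda>"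
    unfolding sets_borel using open_in_lambda_system by (intro \<Lambda>.sigma_sets_subset) auto
  then have "measure_space UNIV (sets borel) outer"
    using measure_down[OF ms] sets.sigma_algebra_axioms[of "borel :: 'a measure"] by simp
  then show ?thesis
    using assms sets.sigma_sets_eq[of "borel :: 'a measure"] unfolding riesz_measure_def
    by (subst emeasure_measure_of_sigma) (auto simp: measure_space_def)
qed

lemma measure_riesz_open: "open U \<Longrightarrow> measure riesz_measure U = content U"
  by (simp add: measure_def emeasure_riesz_measure outer_open)

lemma finite_measure_riesz: "finite_measure riesz_measure"
  by standard (simp add: emeasure_riesz_measure outer_finite flip: infinity_ennreal_def)

text \<open>Outer regularity is built into \<open>outer\<close> as an infimum over open supersets;
  \<open>regular_borel_measureI_outer\<close> supplies the rest.\<close>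

lemma regular_riesz_measure: "regular_borel_measure riesz_measure"
proof (rule regular_borel_measureI_outer[OF compact_space finite_measure_riesz])
  interpret finite_measure riesz_measure by (rule finite_measure_riesz)
  fix A :: "'a set" and e :: real assume A: "A \<in> sets borel" "0 < e"
  then have "outer A < outer A + ennreal e"
    using outer_finite[of A] by (simp add: less_top)
  then obtain U where U: "open U" "A \<subseteq> U" "ennreal (content U) < outer A + ennreal e"
    by (rule outer_close)
  have "outer A + ennreal e = ennreal (measure riesz_measure A + e)"
    using A by (simp add: ennreal_plus flip: emeasure_riesz_measure emeasure_eq_measure)
  then have "ennreal (content U) < ennreal (measure riesz_measure A + e)"
    using U(3) by (simp only:)
  then have "measure riesz_measure U \<le> measure riesz_measure A + e"
    using U(1) A(2) by (simp only: measure_riesz_open ennreal_less_iff content_nonneg less_imp_le)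
  then show "\<exists>U. open U \<and> A \<subseteq> U \<and> measure riesz_measure U \<le> measure riesz_measure A + e"
    using U by blast
qed simp

text \<open>With \<open>f\<^sub>k\<close> the part of \<open>f\<close> between the levels \<open>k / n\<close> and \<open>(k + 1) / n\<close>, the function
  \<open>n f\<^sub>k\<close> is subordinate to \<open>{f > k / n}\<close>.\<close>

lemma le_integral_riesz:
  assumes f: "continuous_on UNIV f" "\<And>x. 0 \<le> f x" "\<And>x. f x \<le> 1"
  shows "L f \<le> (LINT x|riesz_measure. f x)"
proof (rule field_le_epsilon)
  interpret finite_measure riesz_measure by (rule finite_measure_riesz)
  fix e :: real assume "0 < e"
  then obtain m where "inverse (real (Suc m)) < e" using reals_Archimedean by blast
  define n where "n = Suc m"
  have n: "0 < n" "1 / real n < e" using \<open>inverse (real (Suc m)) < e\<close> by (auto simp: n_def inverse_eq_divide)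
  define g where "g k x = max 0 (min 1 (n * f x - real k))" for k :: nat and x
  define U where "U k = {x. real k / n < f x}" for k :: nat
  have g_cont: "continuous_on UNIV (g k)" for k
    unfolding g_def by (intro continuous_intros f)
  have U_open: "open (U k)" for k
    unfolding U_def by (intro open_Collect_less continuous_intros f)
  have g_sub: "g k \<in> subordinate (U k)" for k
    using g_cont[of k] n(1) by (auto simp: subordinate_def g_def U_def max_def min_def field_simps)
  \<comment> \<open>The unit slices of t add up to t cut off at j. At \<open>t = n * f x\<close> and
    \<open>j = n\<close> nothing is cut off, because \<open>f x \<le> 1\<close>.\<close>
  have telescope: "(\<Sum>k<j. max 0 (min 1 (t - real k))) = min t (real j)" if "0 \<le> t" for t :: real and j
    using that by (induction j) (auto simp: max_def min_def)
  have "n * f x = (\<Sum>k<n. g k x)" for x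
    unfolding g_def using f(2,3)[of x] telescope[of "n * f x" n]
    by (simp add: mult_left_le min_def)
  then have "n * L f = (\<Sum>k<n. L (g k))"
    using scale[OF f(1), of n] sum[of "{..<n}" g] g_cont by simp
  also have "\<dots> \<le> (\<Sum>k<n. measure riesz_measure (U k))"
    using U_open g_sub by (intro sum_mono) (simp add: measure_riesz_open content_upper)
  also have "\<dots> = (\<Sum>k<n. LINT x|riesz_measure. indicator (U k) x)"
    by simp
  also have "\<dots> = (LINT x|riesz_measure. (\<Sum>k<n. indicator (U k) x))"
    using U_open by (subst Bochner_Integration.integral_sum) (auto simp: emeasure_eq_measure)
  \<comment> \<open>At most \<open>n * f x + 1\<close> of the levels \<open>k / n\<close> lie below
    \<open>f x\<close>. As the total mass is 1, the excess becomes 1 / n after division by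
    n.\<close>
  also have "\<dots> \<le> (LINT x|riesz_measure. n * f x + 1)"
  proof (rule integral_mono)
    show "integrable riesz_measure (\<lambda>x. \<Sum>k<n. indicat_real (U k) x)"
      using U_open by (intro Bochner_Integration.integrable_sum) (auto simp: emeasure_eq_measure)
    show "integrable riesz_measure (\<lambda>x. n * f x + 1)"
      using f(1) by (intro integrable_continuous_compact compact_space finite_measure_riesz continuous_intros) auto
    have "indicat_real (U k) x = (if real k / n < f x then 1 else 0)" for k x
      by (simp add: U_def)
    then show "(\<Sum>k<n. indicat_real (U k) x) \<le> n * f x + 1" for x
      using layer_count(2)[OF f(2)[of x] f(3)[of x] n(1)] n(1) by (simp add: field_simps)
  qed
  also have "\<dots> = n * (LINT x|riesz_measure. f x) + 1"
    using integrable_continuous_compact[OF compact_space finite_measure_riesz _ f(1)]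
      measure_riesz_open[of UNIV] content_UNIV by simp
  finally have "L f \<le> (LINT x|riesz_measure. f x) + 1 / n"
    using n(1) by (simp add: field_simps)
  then show "L f \<le> (LINT x|riesz_measure. f x) + e"
    using n(2) by simp
qed

text \<open>The inequality for \<open>1 - f\<close> is the reverse inequality for f, because L and
  the integral both send 1 to 1.\<close>

lemma integral_riesz_unit:
  assumes f: "continuous_on UNIV f" "\<And>x. 0 \<le> f x" "\<And>x. f x \<le> 1"
  shows "L f = (LINT x|riesz_measure. f x)"
proof -
  interpret finite_measure riesz_measure by (rule finite_measure_riesz)
  have "L (\<lambda>x. 1 - f x) \<le> (LINT x|riesz_measure. 1 - f x)"
    using f by (intro le_integral_riesz continuous_intros) auto
  then show ?thesis
    using le_integral_riesz[OF f] diff[of "\<lambda>_. 1" f] one f(1)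
      integrable_continuous_compact[OF compact_space finite_measure_riesz _ f(1)]
      measure_riesz_open[of UNIV] content_UNIV by simp
qed

theorem integral_riesz:
  assumes "continuous_on UNIV f"
  shows "L f = (LINT x|riesz_measure. f x)"
proof -
  interpret finite_measure riesz_measure by (rule finite_measure_riesz)
  have "bounded (range f)"
    using compact_continuous_image[OF assms compact_space] by (rule compact_imp_bounded)
  then obtain C where C: "\<And>x. norm (f x) \<le> C" "0 < C" by (auto simp: bounded_pos)
  \<comment> \<open>An affine change of scale from [-C, C] to [0, 1], undone at the end by
    linearity.\<close>
  define g where "g x = (f x + C) / (2 * C)" for x
  have "continuous_on UNIV g"
    using C(2) assms unfolding g_def by (intro continuous_intros) auto
  moreover have "0 \<le> g x" "g x \<le> 1" for x
    using C(1)[of x] C(2) by (auto simp: g_def field_simps abs_le_iff)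
  ultimately have g: "continuous_on UNIV g" "\<And>x. 0 \<le> g x" "\<And>x. g x \<le> 1" .
  have f: "f = (\<lambda>x. 2 * C * g x - C)" using C(2) by (auto simp: g_def)
  have "L f = 2 * C * L g - C"
    unfolding f using diff[of "\<lambda>x. 2 * C * g x" "\<lambda>_. C"] scale[OF g(1)] const g(1)
    by (simp add: continuous_on_mult_left)
  also have "\<dots> = (LINT x|riesz_measure. f x)"
    unfolding f using integral_riesz_unit[OF g]
      integrable_continuous_compact[OF compact_space finite_measure_riesz _ g(1)]
      measure_riesz_open[of UNIV] content_UNIV by simp
  finally show ?thesis .
qed

end

section \<open>Mixtures of a kernel of regular measures\<close>

text \<open>Fubini for a mixture, reduced to \<open>nn_integral_bind\<close> for the positive and
  the negative part. Integrability against the mixture makes both inner integrals finite for almost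
  every y; the exceptional y, where f is not integrable and its integral is 0 by default, form a
  null set.\<close>

lemma integral_bind_kernel:
  fixes f :: "'a \<Rightarrow> real"
  assumes "space M \<noteq> {}" and K [measurable]: "K \<in> measurable M (subprob_algebra N)"
    and f [measurable]: "f \<in> borel_measurable N" and int: "integrable (M \<bind> K) f"
  shows "integral\<^sup>L (M \<bind> K) f = (LINT y|M. (LINT x|K y. f x))"
proof -
  have sets: "sets (M \<bind> K) = sets N"
    using assms(1) by (intro sets_bind sets_kernel[OF K]) auto
  have setsK: "sets (K y) = sets N" if "y \<in> space M" for y
    using sets_kernel[OF K that] .
  \<comment> \<open>\<open>ennreal\<close> truncates negative numbers to 0, so p and q integrate the
    positive and the negative part of f.\<close>
  define p where "p y = (\<integral>\<^sup>+x. ennreal (f x) \<partial>K y)" for y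
  define q where "q y = (\<integral>\<^sup>+x. ennreal (- f x) \<partial>K y)" for y
  have [measurable]: "p \<in> borel_measurable M" "q \<in> borel_measurable M"
    unfolding p_def q_def by measurable
  have pq: "(\<integral>\<^sup>+x. ennreal (f x) \<partial>(M \<bind> K)) = (\<integral>\<^sup>+y. p y \<partial>M)"
    "(\<integral>\<^sup>+x. ennreal (- f x) \<partial>(M \<bind> K)) = (\<integral>\<^sup>+y. q y \<partial>M)"
    unfolding p_def q_def by (rule nn_integral_bind[OF _ K]; measurable)+
  have fin: "(\<integral>\<^sup>+y. p y \<partial>M) \<noteq> \<infinity>" "(\<integral>\<^sup>+y. q y \<partial>M) \<noteq> \<infinity>"
    using int unfolding real_integrable_def pq by auto
  have AE: "AE y in M. p y \<noteq> \<infinity>" "AE y in M. q y \<noteq> \<infinity>"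
    using nn_integral_PInf_AE[of p M] nn_integral_PInf_AE[of q M] fin by simp_all
  \<comment> \<open>\<open>enn2real\<close> sends infinity to 0, hence the condition that g is
    finite almost everywhere.\<close>
  have nn: "(\<integral>\<^sup>+y. ennreal (enn2real (g y)) \<partial>M) = (\<integral>\<^sup>+y. g y \<partial>M)"
    if "AE y in M. g y \<noteq> \<infinity>" for g
    using that by (intro nn_integral_cong_AE) (auto simp: less_top)
  have int': "integrable M (\<lambda>y. enn2real (g y))" "(LINT y|M. enn2real (g y)) = enn2real (\<integral>\<^sup>+y. g y \<partial>M)"
    if [measurable]: "g \<in> borel_measurable M" and g: "(\<integral>\<^sup>+y. g y \<partial>M) \<noteq> \<infinity>" "AE y in M. g y \<noteq> \<infinity>" for g
  proof -
    have "(\<integral>\<^sup>+y. ennreal (enn2real (g y)) \<partial>M) = ennreal (enn2real (\<integral>\<^sup>+y. g y \<partial>M))"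
      using nn[OF g(2)] g(1) by (simp add: less_top)
    then show "integrable M (\<lambda>y. enn2real (g y))"
      by (intro integrableI_nn_integral_finite) auto
    show "(LINT y|M. enn2real (g y)) = enn2real (\<integral>\<^sup>+y. g y \<partial>M)"
      using nn[OF g(2)] by (subst integral_eq_nn_integral) auto
  qed
  have meas: "(\<lambda>y. LINT x|K y. f x) \<in> borel_measurable M" by measurable
  have "AE y in M. (LINT x|K y. f x) = enn2real (p y) - enn2real (q y)"
    using AE AE_space
  proof eventually_elim
    case (elim y)
    have "f \<in> borel_measurable (K y)"
      using f setsK[OF elim(3)] by (simp cong: measurable_cong_sets)
    then have "integrable (K y) f"
      using elim by (simp add: real_integrable_def p_def q_def)
    then show ?case
      by (simp add: real_lebesgue_integral_def p_def q_def)
  qed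
  then have "(LINT y|M. (LINT x|K y. f x)) = (LINT y|M. enn2real (p y) - enn2real (q y))"
    using meas by (intro integral_cong_AE) measurable
  also have "\<dots> = (LINT y|M. enn2real (p y)) - (LINT y|M. enn2real (q y))"
    using fin AE by (intro Bochner_Integration.integral_diff int') auto
  also have "\<dots> = enn2real (\<integral>\<^sup>+y. p y \<partial>M) - enn2real (\<integral>\<^sup>+y. q y \<partial>M)"
    using int'(2)[of p] int'(2)[of q] fin AE by simp
  also have "\<dots> = integral\<^sup>L (M \<bind> K) f"
    using int by (simp add: real_lebesgue_integral_def pq)
  finally show ?thesis by simp
qed

text \<open>A regular measure commutes with the supremum of the directed family of continuous functions
  \<open>y \<mapsto> \<integral> f dK\<^sub>y\<close>, \<open>f\<close> subordinate to \<open>U\<close>, although the family is uncountable: on each level set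
  inner regularity leaves a compact set, which finitely many members of the family cover.\<close>

lemma kernel_open_approx:
  fixes M :: "'b::t2_space measure" and K :: "'b \<Rightarrow> 'a::t2_space measure"
  assumes comp: "compact (UNIV :: 'a set)" "compact (UNIV :: 'b set)"
    and M: "prob_space M" "regular_borel_measure M"
    and K: "\<And>y. prob_space (K y)" "\<And>y. regular_borel_measure (K y)"
    and feller: "\<And>f :: 'a \<Rightarrow> real. continuous_on UNIV f \<Longrightarrow> continuous_on UNIV (\<lambda>y. LINT x|K y. f x)"
    and U: "open U" "(\<lambda>y. measure (K y) U) \<in> borel_measurable borel" and "0 < e"
  obtains f where "f \<in> subordinate U" "(LINT y|M. measure (K y) U) \<le> (LINT y|M. (LINT x|K y. f x)) + e"
proof -
  interpret prob_space M by fact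
  note setsM = regular_borel_measureD(1)[OF M(2)] and spaceM = regular_borel_measureD(2)[OF M(2)]
  have fK: "finite_measure (K y)" for y
    using K(1) by (simp add: prob_space.finite_measure)
  have int_K: "integrable (K y) f" if "continuous_on UNIV f" for y and f :: "'a \<Rightarrow> real"
    by (rule integrable_continuous_compact[OF comp(1) fK regular_borel_measureD(1)[OF K(2)] that])
  define h where "h y = measure (K y) U" for y
  define F where "F f y = (LINT x|K y. f x)" for f :: "'a \<Rightarrow> real" and y
  have h_unit: "0 \<le> h y" "h y \<le> 1" for y
    using K(1) by (auto simp: h_def prob_space.prob_le_1)
  have F_mono: "F f y \<le> F g y" if "f \<in> subordinate U" "g \<in> subordinate U" "\<And>x. f x \<le> g x" for f g y
    unfolding F_def using that by (intro integral_mono int_K subordinateD)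
  have F_le: "F f y \<le> h y" if "f \<in> subordinate U" for f y
    unfolding F_def h_def using that U fK K by (intro integral_subordinate_le comp regular_borel_measureD)
  have F_nonneg: "0 \<le> F f y" if "f \<in> subordinate U" for f y
    unfolding F_def using that by (intro Bochner_Integration.integral_nonneg subordinateD)
  have F_cont: "continuous_on UNIV (F f)" if "f \<in> subordinate U" for f
    unfolding F_def using that by (intro feller subordinateD)
  have meas_h [measurable]: "h \<in> borel_measurable M"
    using U(2) setsM unfolding h_def by (simp cong: measurable_cong_sets)
  have open_level: "open {y. t < F f y}" if "f \<in> subordinate U" for t f
    using F_cont[OF that] by (intro open_Collect_less continuous_intros) auto
  have level: "\<exists>f\<in>subordinate U. measure M {y. t < h y} - d \<le> measure M {y. t < F f y}" if "0 < d" for t d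
  proof -
    have "{y. t < h y} \<in> sets borel"
      using U(2) unfolding h_def by measurable
    then obtain C where C: "compact C" "C \<subseteq> {y. t < h y}" "measure M {y. t < h y} - d < measure M C"
      using regular_borel_measure_inner[OF comp(2) M(2) _ \<open>0 < d\<close>] by blast
    have "\<exists>f\<in>subordinate U. y \<in> {y. t < F f y}" if "y \<in> C" for y
    proof -
      \<comment> \<open>The gap above the level t is the tolerance, so the integral of f still
        exceeds t at y.\<close>
      have "0 < h y - t" using C(2) that by auto
      then obtain f where "f \<in> subordinate U" "measure (K y) U - (h y - t) < (LINT x|K y. f x)"
        using regular_borel_measure_subordinate[OF comp(1) K(2) U(1)] by blast
      then show ?thesis by (auto simp: F_def h_def)
    qed
    then have "C \<subseteq> (\<Union>f\<in>subordinate U. {y. t < F f y})" by blast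
    then obtain D where D: "D \<subseteq> subordinate U" "finite D" "C \<subseteq> (\<Union>f\<in>D. {y. t < F f y})"
      using compactE_image[OF C(1), of "subordinate U" "\<lambda>f. {y. t < F f y}"] open_level by metis
    obtain g where g: "g \<in> subordinate U" "\<forall>f\<in>D. \<forall>x. f x \<le> g x"
      using finite_subordinate_upper_bound[OF D(2,1)] by blast
    have "C \<subseteq> {y. t < F g y}"
    proof
      fix y assume "y \<in> C"
      then obtain f where "f \<in> D" "t < F f y" using D(3) by blast
      then show "y \<in> {y. t < F g y}" using F_mono[of f g y] D(1) g by auto
    qed
    then have "measure M C \<le> measure M {y. t < F g y}"
      using open_level[OF g(1)] by (intro finite_measure_mono) (auto simp: setsM)
    then show ?thesis using C(3) g(1) by (intro bexI[of _ g]) auto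
  qed
  \<comment> \<open>Two errors of 1 / n arise: the n level sets lose 1 / n each, which is 1 before
    division by n, and counting levels overestimates \<open>n * F g y\<close> by at most 1.\<close>
  obtain m where "inverse (real (Suc m)) < e / 2" using reals_Archimedean[of "e / 2"] \<open>0 < e\<close> by auto
  define n where "n = Suc m"
  have n: "0 < n" "1 / real n < e / 2"
    using \<open>inverse (real (Suc m)) < e / 2\<close> by (simp_all only: n_def inverse_eq_divide zero_less_Suc)
  have "0 < 1 / real n" using n(1) by simp
  from level[OF this] have "\<forall>k. \<exists>f. f \<in> subordinate U \<and>
      measure M {y. real k / n < h y} - 1 / n \<le> measure M {y. real k / n < F f y}"
    by blast
  then obtain f where f: "\<And>k. f k \<in> subordinate U"
      "\<And>k. measure M {y. real k / n < h y} - 1 / n \<le> measure M {y. real k / n < F (f k) y}"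
    using choice[of "\<lambda>k f. f \<in> subordinate U \<and>
      measure M {y. real k / n < h y} - 1 / n \<le> measure M {y. real k / n < F f y}"] by blast
  \<comment> \<open>A single g above the n chosen functions serves all levels at once.\<close>
  obtain g where g: "g \<in> subordinate U" "\<forall>f'\<in>f ` {..<n}. \<forall>x. f' x \<le> g x"
    using finite_subordinate_upper_bound[of "f ` {..<n}" U] f(1) by blast
  have meas_F [measurable]: "F g \<in> borel_measurable M"
    using borel_measurable_continuous_onI[OF F_cont[OF g(1)]] setsM by (simp cong: measurable_cong_sets)
  have F_unit: "0 \<le> F g y" "F g y \<le> 1" for y
    using F_nonneg F_le[OF g(1), of y] h_unit[of y] g(1) by auto
  have layers: "(LINT y|M. (\<Sum>k<n. if real k / n < u y then 1 else 0)) = (\<Sum>k<n. measure M {y. real k / n < u y})"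
    "integrable M (\<lambda>y. (\<Sum>k<n. if real k / n < u y then 1 else (0::real)))"
    if [measurable]: "u \<in> borel_measurable M" for u
  proof -
    have ind: "(if real k / n < u y then 1 else 0) = indicat_real {y. real k / n < u y} y" for k y
      by (simp add: indicator_def)
    have meas: "{y. real k / n < u y} \<in> sets M" for k
      using spaceM measurable_sets[OF that, of "{real k / n<..}"] by (simp add: vimage_def)
    show "integrable M (\<lambda>y. (\<Sum>k<n. if real k / n < u y then 1 else (0::real)))"
      unfolding ind using meas by (intro Bochner_Integration.integrable_sum) (auto simp: emeasure_eq_measure)
    show "(LINT y|M. (\<Sum>k<n. if real k / n < u y then 1 else 0)) = (\<Sum>k<n. measure M {y. real k / n < u y})"
      unfolding ind using meas by (subst Bochner_Integration.integral_sum) (auto simp: emeasure_eq_measure spaceM)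
  qed
  have int_h: "integrable M h" and int_F: "integrable M (F g)"
    using h_unit F_unit by (auto intro!: integrable_const_bound[of _ 1])
  have "n * (LINT y|M. h y) \<le> (LINT y|M. (\<Sum>k<n. if real k / n < h y then 1 else 0))"
    using layer_count(1)[OF h_unit n(1)] n(1) int_h layers(2)[of h]
    by (subst integral_mult_right_zero[symmetric], intro integral_mono) (auto simp: field_simps)
  also have "\<dots> = (\<Sum>k<n. measure M {y. real k / n < h y})"
    by (rule layers) measurable
  also have "\<dots> \<le> (\<Sum>k<n. measure M {y. real k / n < F g y} + 1 / n)"
  proof (rule sum_mono)
    fix k assume "k \<in> {..<n}"
    then have "{y. real k / n < F (f k) y} \<subseteq> {y. real k / n < F g y}"
      using F_mono[OF f(1) g(1)] g(2) by (auto intro: less_le_trans)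
    then have "measure M {y. real k / n < F (f k) y} \<le> measure M {y. real k / n < F g y}"
      using open_level[OF g(1)] by (intro finite_measure_mono) (auto simp: setsM)
    then show "measure M {y. real k / n < h y} \<le> measure M {y. real k / n < F g y} + 1 / n"
      using f(2)[of k] by linarith
  qed
  also have "\<dots> = (LINT y|M. (\<Sum>k<n. if real k / n < F g y then 1 else 0)) + 1"
    using n(1) layers(1)[OF meas_F] by (simp add: sum.distrib)
  also have "(LINT y|M. (\<Sum>k<n. if real k / n < F g y then 1 else 0)) \<le> (LINT y|M. n * F g y + 1)"
    using layer_count(2)[OF F_unit n(1)] n(1) int_F layers(2)[of "F g"]
    by (intro integral_mono) (auto simp: field_simps)
  also have "(LINT y|M. n * F g y + 1) = n * (LINT y|M. F g y) + 1"
    using int_F by (simp add: prob_space)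
  finally have "(LINT y|M. h y) \<le> (LINT y|M. F g y) + 2 / n"
    using n(1) by (simp add: field_simps)
  then show ?thesis
    using n(2) by (intro that[OF g(1)]) (auto simp: h_def F_def)
qed

lemma regular_measure_eq_bind:
  fixes M :: "'b::t2_space measure" and K :: "'b \<Rightarrow> 'a::t2_space measure"
  assumes comp: "compact (UNIV :: 'a set)" "compact (UNIV :: 'b set)"
    and M: "prob_space M" "regular_borel_measure M" and N: "regular_borel_measure N"
    and K: "\<And>y. prob_space (K y)" "\<And>y. regular_borel_measure (K y)"
    and K_meas: "K \<in> measurable borel (subprob_algebra borel)"
    and feller: "\<And>f :: 'a \<Rightarrow> real. continuous_on UNIV f \<Longrightarrow> continuous_on UNIV (\<lambda>y. LINT x|K y. f x)"
    and eq: "\<And>f :: 'a \<Rightarrow> real. continuous_on UNIV f \<Longrightarrow> (LINT x|N. f x) = (LINT y|M. (LINT x|K y. f x))"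
  shows "N = M \<bind> K"
proof (rule borel_measure_eqI_open)
  interpret prob_space M by fact
  note setsM = regular_borel_measureD(1)[OF M(2)] and spaceM = regular_borel_measureD(2)[OF M(2)]
  have fK: "finite_measure (K y)" for y
    using K(1) by (simp add: prob_space.finite_measure)
  have K_meas': "K \<in> measurable M (subprob_algebra borel)"
    using K_meas setsM by (simp cong: measurable_cong_sets)
  show fN: "finite_measure N" by (rule finite_measure_regular_borel[OF comp(1) N])
  have "subprob_space (M \<bind> K)"
    by (rule subprob_space_bind[OF prob_space_imp_subprob_space[OF M(1)] K_meas'])
  then show "finite_measure (M \<bind> K)"
    by (simp add: subprob_space_def)
  show sets_N: "sets N = sets borel" by (rule regular_borel_measureD[OF N])
  show "sets (M \<bind> K) = sets borel"
    using K(2) spaceM by (intro sets_bind) (auto simp: regular_borel_measureD)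
  fix U :: "'a set" assume U: "open U"
  have U_meas [measurable]: "(\<lambda>y. measure (K y) U) \<in> borel_measurable borel"
    using U measurable_compose[OF K_meas measurable_measure_subprob_algebra] by simp
  have bind_U: "measure (M \<bind> K) U = (LINT y|M. measure (K y) U)"
    using U by (intro measure_bind[OF K_meas']) auto
  show "measure N U = measure (M \<bind> K) U"
  proof (rule antisym; rule field_le_epsilon)
    fix e :: real assume "0 < e"
    obtain f where f: "f \<in> subordinate U" "measure N U - e < (LINT x|N. f x)"
      using regular_borel_measure_subordinate[OF comp(1) N U \<open>0 < e\<close>] by blast
    have "(LINT x|N. f x) = (LINT y|M. (LINT x|K y. f x))"
      using f by (intro eq subordinateD)
    also have "\<dots> \<le> (LINT y|M. measure (K y) U)"
    proof (rule integral_mono)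
      show "integrable M (\<lambda>y. LINT x|K y. f x)"
        using f by (intro integrable_continuous_compact[OF comp(2) _ setsM] feller subordinateD) unfold_locales
      show "integrable M (\<lambda>y. measure (K y) U)"
        using U_meas setsM K(1)
        by (intro integrable_const_bound[of _ 1]) (auto simp: prob_space.prob_le_1 cong: measurable_cong_sets)
      show "(LINT x|K y. f x) \<le> measure (K y) U" for y
        using f U fK K by (intro integral_subordinate_le comp regular_borel_measureD)
    qed
    finally show "measure N U \<le> measure (M \<bind> K) U + e"
      using f(2) bind_U by simp
  next
    fix e :: real assume "0 < e"
    obtain f where f: "f \<in> subordinate U"
        "(LINT y|M. measure (K y) U) \<le> (LINT y|M. (LINT x|K y. f x)) + e"
      using kernel_open_approx[OF comp M K feller U U_meas \<open>0 < e\<close>] by blast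
    have "(LINT x|N. f x) = (LINT y|M. (LINT x|K y. f x))"
      using f by (intro eq subordinateD)
    moreover have "(LINT x|N. f x) \<le> measure N U"
      using f U fN sets_N by (intro integral_subordinate_le comp)
    ultimately show "measure (M \<bind> K) U \<le> measure N U + e"
      using f(2) bind_U by simp
  qed
qed

section \<open>Operators and tensors\<close>

lemma apply_Bcontfun_compact:
  fixes f :: "'b::topological_space \<Rightarrow> real"
  assumes "compact (UNIV :: 'b set)" "continuous_on UNIV f"
  shows "apply_bcontfun (Bcontfun f) = f"
proof -
  have "bounded (range f)"
    using compact_continuous_image[OF assms(2,1)] by (rule compact_imp_bounded)
  then show ?thesis
    using assms(2) by (intro Bcontfun_inverse) (simp add: bcontfun_def)
qed

text \<open>Uniqueness in the Riesz theorem resolves the definite description in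
  \<open>repr_measure\<close>.\<close>

lemma repr_measure_eqI:
  fixes R :: "('b::t2_space \<Rightarrow>\<^sub>C real) \<Rightarrow> ('b \<Rightarrow>\<^sub>C real)"
  assumes comp: "compact (UNIV :: 'b set)" and M: "regular_borel_measure M"
    and repr: "\<And>\<phi>. apply_bcontfun (R \<phi>) x = (LINT y|M. apply_bcontfun \<phi> y)"
  shows "repr_measure R x = M"
  unfolding repr_measure_def
proof (rule the_equality)
  fix N assume N: "regular_borel_measure N \<and> (\<forall>\<phi>. apply_bcontfun (R \<phi>) x = (LINT y|N. apply_bcontfun \<phi> y))"
  show "N = M"
  proof (rule regular_borel_measure_eqI[OF comp])
    fix f :: "'b \<Rightarrow> real" assume "continuous_on UNIV f"
    then have "apply_bcontfun (Bcontfun f) = f" by (rule apply_Bcontfun_compact[OF comp])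
    then show "(LINT y|N. f y) = (LINT y|M. f y)"
      using N repr[of "Bcontfun f"] by metis
  qed (use N M in auto)
qed (use M repr in auto)

text \<open>The Riesz theorem applies to evaluation of R at x; \<open>R 1 = 1\<close> provides the
  normalization that \<open>state_functional\<close> asks for.\<close>

lemma
  fixes R :: "('b::t2_space \<Rightarrow>\<^sub>C real) \<Rightarrow> ('b \<Rightarrow>\<^sub>C real)"
  assumes comp: "compact (UNIV :: 'b set)"
    and R: "linear R" "positive_op R" "R (const_bcontfun 1) = const_bcontfun 1"
  shows regular_repr_measure: "regular_borel_measure (repr_measure R x)"
    and integral_repr_measure: "(LINT y|repr_measure R x. apply_bcontfun \<phi> y) = apply_bcontfun (R \<phi>) x"
proof -
  note app = apply_Bcontfun_compact[OF comp]
  interpret linear R by fact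
  interpret L: state_functional "\<lambda>f. apply_bcontfun (R (Bcontfun f)) x"
  proof
    fix f g :: "'b \<Rightarrow> real" and c :: real
    assume f: "continuous_on UNIV f"
    have "Bcontfun (\<lambda>x. c * f x) = c *\<^sub>R Bcontfun f"
      by (rule bcontfun_eqI) (simp add: app f continuous_on_mult_left)
    then show "apply_bcontfun (R (Bcontfun (\<lambda>x. c * f x))) x = c * apply_bcontfun (R (Bcontfun f)) x"
      by (simp add: scale)
    show "0 \<le> apply_bcontfun (R (Bcontfun f)) x" if "\<And>x. 0 \<le> f x"
      using R(2) that by (simp add: positive_op_def app f)
    assume g: "continuous_on UNIV g"
    have "Bcontfun (\<lambda>x. f x + g x) = Bcontfun f + Bcontfun g"
      by (rule bcontfun_eqI) (simp add: app f g continuous_on_add)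
    then show "apply_bcontfun (R (Bcontfun (\<lambda>x. f x + g x))) x =
        apply_bcontfun (R (Bcontfun f)) x + apply_bcontfun (R (Bcontfun g)) x"
      by (simp add: add)
  next
    have "Bcontfun (\<lambda>_::'b. 1) = const_bcontfun (1::real)"
      by (rule bcontfun_eqI) (simp add: app)
    then show "apply_bcontfun (R (Bcontfun (\<lambda>_. 1))) x = 1"
      using R(3) by simp
  qed (rule comp)
  have *: "repr_measure R x = L.riesz_measure"
  proof (rule repr_measure_eqI[OF comp L.regular_riesz_measure])
    show "apply_bcontfun (R \<phi>) x = (LINT y|L.riesz_measure. apply_bcontfun \<phi> y)" for \<phi>
      using L.integral_riesz[OF continuous_on_apply_bcontfun[of UNIV \<phi>]]
      by (simp add: apply_bcontfun_inverse)
  qed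
  show "regular_borel_measure (repr_measure R x)"
    unfolding * by (rule L.regular_riesz_measure)
  show "(LINT y|repr_measure R x. apply_bcontfun \<phi> y) = apply_bcontfun (R \<phi>) x"
    using L.integral_riesz[OF continuous_on_apply_bcontfun[of UNIV \<phi>]]
    unfolding * by (simp add: apply_bcontfun_inverse)
qed

section \<open>The shift, tensors and their density\<close>

lemma continuous_on_seq_shift: "continuous_on UNIV (seq_shift :: (nat \<Rightarrow> 'b::topological_space) \<Rightarrow> _)"
  unfolding seq_shift_def by (rule continuous_on_coordinatewise_then_product) (rule continuous_on_product_coordinates)

lemma measurable_seq_shift [measurable]:
  "(seq_shift :: (nat \<Rightarrow> 'b::topological_space) \<Rightarrow> _) \<in> borel_measurable borel"
  by (rule borel_measurable_continuous_onI[OF continuous_on_seq_shift])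

lemma tensor_Nil [simp]: "tensor [] \<omega> = 1"
  by (simp add: tensor_def)

lemma tensor_Cons [simp]: "tensor (\<phi> # \<phi>s) \<omega> = apply_bcontfun \<phi> (\<omega> 0) * tensor \<phi>s (seq_shift \<omega>)"
  by (simp add: tensor_def seq_shift_def prod.lessThan_Suc_shift del: prod.lessThan_Suc)

lemma continuous_on_tensor: "continuous_on UNIV (tensor \<phi>s)"
  unfolding tensor_def
  by (intro continuous_on_prod continuous_on_compose2[OF continuous_on_apply_bcontfun continuous_on_product_coordinates]) auto

text \<open>Factors are multiplied coordinate by coordinate. Where one list has ended, its missing
  factors count as 1 and the tail of the other list is kept.\<close>

lemma tensor_mult:
  "\<exists>\<chi>s. \<forall>\<omega>. tensor \<chi>s \<omega> = tensor \<phi>s \<omega> * tensor \<psi>s \<omega>"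
proof (induction \<phi>s arbitrary: \<psi>s)
  case Nil
  then show ?case by auto
next
  case (Cons \<phi> \<phi>s)
  show ?case
  proof (cases \<psi>s)
    case Nil
    then show ?thesis by (intro exI[of _ "\<phi> # \<phi>s"]) simp
  next
    case \<psi>: (Cons \<psi> \<psi>s')
    obtain \<chi>s where "\<forall>\<omega>. tensor \<chi>s \<omega> = tensor \<phi>s \<omega> * tensor \<psi>s' \<omega>"
      using Cons.IH by blast
    then show ?thesis
      by (intro exI[of _ "mult_op \<phi> \<psi> # \<chi>s"]) (simp add: \<psi>)
  qed
qed

text \<open>Padding with factors 1 puts a function of any single coordinate among the tensors, which
  is how they separate points.\<close>

lemma tensor_coordinate: "tensor (replicate i (const_bcontfun 1) @ [\<phi>]) \<omega> = apply_bcontfun \<phi> (\<omega> i)"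
  by (induction i arbitrary: \<omega>) (simp_all add: seq_shift_def)

text \<open>Scalars enter as constant factors of tensors, so closure under sums is enough to form a
  subalgebra.\<close>

inductive tensor_sum :: "((nat \<Rightarrow> 'b::topological_space) \<Rightarrow> real) \<Rightarrow> bool" where
  tensor: "tensor_sum (tensor \<phi>s)"
| add: "tensor_sum f \<Longrightarrow> tensor_sum g \<Longrightarrow> tensor_sum (\<lambda>\<omega>. f \<omega> + g \<omega>)"

lemma continuous_on_tensor_sum: "tensor_sum f \<Longrightarrow> continuous_on UNIV f"
  by (induction rule: tensor_sum.induct) (auto intro: continuous_on_tensor continuous_on_add)

lemma tensor_sum_mult:
  assumes "tensor_sum f" "tensor_sum g"
  shows "tensor_sum (\<lambda>\<omega>. f \<omega> * g \<omega>)"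
  using assms
proof (induction rule: tensor_sum.induct)
  case (tensor \<phi>s)
  then show ?case
  proof (induction rule: tensor_sum.induct)
    case (tensor \<psi>s)
    obtain \<chi>s where "\<forall>\<omega>. tensor \<chi>s \<omega> = tensor \<phi>s \<omega> * tensor \<psi>s \<omega>"
      using tensor_mult by blast
    then have "(\<lambda>\<omega>. tensor \<phi>s \<omega> * tensor \<psi>s \<omega>) = tensor \<chi>s" by auto
    then show ?case by (simp add: tensor_sum.tensor)
  next
    case (add f g)
    then show ?case by (simp add: distrib_left tensor_sum.add)
  qed
next
  case (add f g)
  then show ?case by (simp add: distrib_right tensor_sum.add)
qed

lemma tensor_sum_dense:
  fixes f :: "(nat \<Rightarrow> 'b::t2_space) \<Rightarrow> real"
  assumes comp: "compact (UNIV :: 'b set)" and f: "continuous_on UNIV f" and "0 < e"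
  shows "\<exists>g. tensor_sum g \<and> (\<forall>\<omega>. \<bar>f \<omega> - g \<omega>\<bar> < e)"
proof -
  interpret function_ring_on "{g :: (nat \<Rightarrow> 'b) \<Rightarrow> real. tensor_sum g}" UNIV
  proof
    show "compact (UNIV :: (nat \<Rightarrow> 'b) set)" by (rule compact_UNIV_fun[OF comp])
    show "(\<lambda>_. c) \<in> {g :: (nat \<Rightarrow> 'b) \<Rightarrow> real. tensor_sum g}" for c
    proof -
      have eq: "tensor [const_bcontfun c :: 'b \<Rightarrow>\<^sub>C real] = (\<lambda>_. c)" by (rule ext) simp
      show ?thesis
        using tensor_sum.tensor[of "[const_bcontfun c :: 'b \<Rightarrow>\<^sub>C real]"] unfolding eq by simp
    qed
    fix \<omega> \<omega>' :: "nat \<Rightarrow> 'b" assume "\<omega> \<noteq> \<omega>'"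
    then obtain i where "\<omega> i \<noteq> \<omega>' i" by auto
    then have disj: "{\<omega> i} \<inter> {\<omega>' i} = {}" by simp
    obtain \<phi> :: "'b \<Rightarrow> real" where \<phi>: "continuous_on UNIV \<phi>"
        "\<And>x. x \<in> {\<omega> i} \<Longrightarrow> \<phi> x = 0" "\<And>x. x \<in> {\<omega>' i} \<Longrightarrow> \<phi> x = 1"
      by (rule urysohn_compact_t2[OF comp closed_singleton closed_singleton disj]) (rule that; assumption)
    define g where "g = tensor (replicate i (const_bcontfun 1) @ [Bcontfun \<phi>])"
    have "tensor_sum g" "g \<omega> \<noteq> g \<omega>'"
      unfolding g_def by (auto intro: tensor_sum.tensor simp: tensor_coordinate apply_Bcontfun_compact[OF comp] \<phi>)
    then show "\<exists>g\<in>{g. tensor_sum g}. g \<omega> \<noteq> g \<omega>'" by blast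
  qed (auto intro: continuous_on_tensor_sum tensor_sum.add tensor_sum_mult)
  show ?thesis
    using Stone_Weierstrass_basic[OF f \<open>0 < e\<close>] by auto
qed

lemma (in prob_space) integral_near:
  fixes g k :: "'a \<Rightarrow> real"
  assumes "integrable M g" "integrable M k" "\<And>x. \<bar>g x - k x\<bar> \<le> e"
  shows "\<bar>(LINT x|M. g x) - (LINT x|M. k x)\<bar> \<le> e"
proof -
  have "\<bar>LINT x|M. g x - k x\<bar> \<le> (LINT x|M. \<bar>g x - k x\<bar>)"
    by (rule integral_abs_bound)
  also have "\<dots> \<le> (LINT x|M. e)"
    using assms by (intro integral_mono) auto
  finally show ?thesis using assms prob_space by simp
qed

section \<open>Fields of measures on the fibers\<close>

locale path_field =
  fixes P :: "'b::t2_space \<Rightarrow> (nat \<Rightarrow> 'b) measure"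
  assumes comp: "compact (UNIV :: 'b set)"
    and prob: "\<And>x. prob_space (P x)"
    and regular: "\<And>x. regular_borel_measure (P x)"
    and carried: "\<And>x. emeasure (P x) (fiber x) = 1"
    and kernel: "\<And>A. A \<in> sets borel \<Longrightarrow> (\<lambda>x. emeasure (P x) A) \<in> borel_measurable borel"
begin

lemmas comp_seq = compact_UNIV_fun[OF comp, where 'i = nat]

lemma sets_P [simp, measurable_cong]: "sets (P x) = sets borel"
  by (rule regular_borel_measureD[OF regular])

lemma space_P [simp]: "space (P x) = UNIV"
  by (rule regular_borel_measureD[OF regular])

lemma finite_P: "finite_measure (P x)"
  by (intro prob_space.finite_measure prob)

lemma measurable_P: "P \<in> measurable borel (subprob_algebra borel)"
  by (rule measurable_subprob_algebra) (auto intro: prob_space_imp_subprob_space prob kernel)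

lemma fiber_borel [measurable]: "fiber x \<in> sets (borel :: (nat \<Rightarrow> 'b) measure)"
proof -
  have "closed ((\<lambda>\<omega> :: nat \<Rightarrow> 'b. \<omega> 0) -` {x})"
    by (intro closed_vimage closed_singleton continuous_on_product_coordinates)
  then show ?thesis by (simp add: fiber_def proj1_def[abs_def] vimage_def)
qed

text \<open>This turns integrals over the fiber into integrals over the whole space, and lets
  \<open>\<omega> 0\<close> be replaced by x under \<open>P x\<close>.\<close>

lemma AE_fiber: "AE \<omega> in P x. \<omega> \<in> fiber x"
  using prob_space.AE_in_set_eq_1[OF prob[of x], of "fiber x"] carried[of x]
  by (simp add: measure_def)

lemma set_integrable_fiber_iff:
  fixes f :: "(nat \<Rightarrow> 'b) \<Rightarrow> real"
  assumes [measurable]: "f \<in> borel_measurable borel"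
  shows "set_integrable (P x) (fiber x) f \<longleftrightarrow> integrable (P x) f"
  unfolding set_integrable_def using AE_fiber[of x]
  by (intro integrable_cong_AE) (auto elim: eventually_mono)

lemma cond_exp_fiber_eq:
  assumes [measurable]: "f \<in> borel_measurable borel"
  shows "cond_exp_fiber P x f = (LINT \<omega>|P x. f \<omega>)"
  unfolding cond_exp_fiber_def set_lebesgue_integral_def using AE_fiber[of x]
  by (intro integral_cong_AE) (auto elim: eventually_mono)

lemma integrable_P_continuous:
  fixes f :: "(nat \<Rightarrow> 'b) \<Rightarrow> real"
  assumes "continuous_on UNIV f"
  shows "integrable (P x) f"
  by (rule integrable_continuous_compact[OF comp_seq finite_P sets_P assms])

text \<open>The first coordinate is almost surely x under \<open>P x\<close>, so the first factor is
  a constant. This is the source of the outermost multiplication operator in the words of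
  (a).\<close>

lemma integral_P_Cons:
  "(LINT \<omega>|P x. tensor (\<phi> # \<psi>s) \<omega>) = apply_bcontfun \<phi> x * (LINT \<omega>|P x. tensor \<psi>s (seq_shift \<omega>))"
proof -
  have [measurable]: "tensor \<chi>s \<in> borel_measurable borel" for \<chi>s :: "('b \<Rightarrow>\<^sub>C real) list"
    by (rule borel_measurable_continuous_onI[OF continuous_on_tensor])
  have "(LINT \<omega>|P x. tensor (\<phi> # \<psi>s) \<omega>) = (LINT \<omega>|P x. apply_bcontfun \<phi> x * tensor \<psi>s (seq_shift \<omega>))"
  proof (rule integral_cong_AE)
    show "AE \<omega> in P x. tensor (\<phi> # \<psi>s) \<omega> = apply_bcontfun \<phi> x * tensor \<psi>s (seq_shift \<omega>)"
      using AE_fiber[of x] by eventually_elim (simp add: fiber_def proj1_def)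
  qed measurable
  then show ?thesis by simp
qed

lemma word_integral_imp_shift_identity:
  fixes R :: "('b \<Rightarrow>\<^sub>C real) \<Rightarrow> ('b \<Rightarrow>\<^sub>C real)"
  assumes R: "linear R" "positive_op R" "R (const_bcontfun 1) = const_bcontfun 1"
    and word: "\<And>x \<phi> \<psi>s. (LINT \<omega>|P x. tensor (\<phi> # \<psi>s) \<omega>) = apply_bcontfun (alternating_word R \<phi> \<psi>s) x"
    and f [measurable]: "f \<in> borel_measurable borel" and ex: "integrals_exist P R x f"
  shows "cond_exp_fiber P x (f \<circ> seq_shift) = borel_extension R (\<lambda>y. cond_exp_fiber P y f) x"
proof -
  define M where "M = repr_measure R x"
  define N where "N = distr (P x) borel seq_shift"
  note regM = regular_repr_measure[OF comp R, of x, folded M_def]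
  note intM = integral_repr_measure[OF comp R, of x, folded M_def]
  have probM: "prob_space M"
  proof
    interpret finite_measure M by (rule finite_measure_regular_borel[OF comp regM])
    have "measure M (space M) = 1"
      using intM[of "const_bcontfun 1"] R(3) by simp
    then show "emeasure M (space M) = 1" by (simp add: emeasure_eq_measure)
  qed
  have "regular_borel_measure N"
    unfolding N_def by (rule regular_borel_measure_distr[OF comp_seq comp_seq regular continuous_on_seq_shift])
  have word_shift: "(LINT \<omega>|P y. tensor (\<phi> # \<psi>s) (seq_shift \<omega>)) = apply_bcontfun (R (alternating_word R \<phi> \<psi>s)) y"
    for y \<phi> \<psi>s
  proof -
    \<comment> \<open>A leading factor 1 turns the shifted tensor into an ordinary one; in the word
      it leaves R applied to the shorter word.\<close>
    have "(LINT \<omega>|P y. tensor (\<phi> # \<psi>s) (seq_shift \<omega>)) = (LINT \<omega>|P y. tensor (const_bcontfun 1 # \<phi> # \<psi>s) \<omega>)"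
      by (subst integral_P_Cons) simp
    also have "\<dots> = apply_bcontfun (R (alternating_word R \<phi> \<psi>s)) y"
      by (subst word) (simp add: alternating_word_def)
    finally show ?thesis .
  qed
  have int_shift: "integrable (P y) (\<lambda>\<omega>. g (seq_shift \<omega>))" if "continuous_on UNIV g" for y and g :: "(nat \<Rightarrow> 'b) \<Rightarrow> real"
    using continuous_on_compose2[OF that continuous_on_seq_shift] by (intro integrable_P_continuous) auto
  \<comment> \<open>Continuity in y goes along with the identity, since it makes the inner integrals
    integrable under M, as additivity requires.\<close>
  have sum: "continuous_on UNIV (\<lambda>y. LINT \<omega>|P y. g \<omega>) \<and>
      (LINT \<omega>|P x. g (seq_shift \<omega>)) = (LINT y|M. (LINT \<omega>|P y. g \<omega>))" if "tensor_sum g" for g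
    using that
  proof (induction rule: tensor_sum.induct)
    case (tensor \<phi>s)
    \<comment> \<open>A word has at least one factor, so the empty tensor is rewritten with the
      single factor 1.\<close>
    obtain \<phi> \<psi>s where "tensor \<phi>s = tensor (\<phi> # \<psi>s)"
    proof (cases \<phi>s)
      case Nil
      then have "tensor \<phi>s = tensor (const_bcontfun 1 # [])" by auto
      then show ?thesis by (rule that)
    qed auto
    then show ?case
      using word_shift[where y = x] intM continuous_on_apply_bcontfun by (simp add: word del: tensor_Cons)
  next
    case (add f g)
    note c = add.hyps[THEN continuous_on_tensor_sum]
    have M_int: "integrable M (\<lambda>y. LINT \<omega>|P y. f \<omega>)" "integrable M (\<lambda>y. LINT \<omega>|P y. g \<omega>)"
      using add.IH by (auto intro!: integrable_continuous_compact[OF comp]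
        finite_measure_regular_borel[OF comp regM] regular_borel_measureD[OF regM])
    show ?case
      using add.IH c M_int by (simp add: integrable_P_continuous int_shift continuous_on_add)
  qed
  \<comment> \<open>Integration against probability measures does not increase uniform distance, so
    uniform approximation by tensor sums gives a uniform limit of continuous functions of y.\<close>
  have feller: "continuous_on UNIV (\<lambda>y. LINT \<omega>|P y. g \<omega>)"
    if g: "continuous_on UNIV g" for g :: "(nat \<Rightarrow> 'b) \<Rightarrow> real"
  proof -
    have "\<exists>h. tensor_sum h \<and> (\<forall>\<omega>. \<bar>g \<omega> - h \<omega>\<bar> < inverse (Suc n))" for n
      by (rule tensor_sum_dense[OF comp g]) simp
    then obtain h where h: "\<And>n. tensor_sum (h n)" "\<And>n \<omega>. \<bar>g \<omega> - h n \<omega>\<bar> < inverse (Suc n)"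
      by metis
    show ?thesis
    proof (rule uniform_limit_theorem)
      show "\<forall>\<^sub>F n in sequentially. continuous_on UNIV (\<lambda>y. LINT \<omega>|P y. h n \<omega>)"
        using sum h(1) by simp
      show "uniform_limit UNIV (\<lambda>n y. LINT \<omega>|P y. h n \<omega>) (\<lambda>y. LINT \<omega>|P y. g \<omega>) sequentially"
        unfolding uniform_limit_iff
      proof (intro allI impI)
        fix e :: real assume "0 < e"
        have "\<forall>\<^sub>F n in sequentially. inverse (real (Suc n)) < e"
          using LIMSEQ_inverse_real_of_nat \<open>0 < e\<close> by (rule order_tendstoD)
        then show "\<forall>\<^sub>F n in sequentially. \<forall>y\<in>UNIV. dist (LINT \<omega>|P y. h n \<omega>) (LINT \<omega>|P y. g \<omega>) < e"
        proof eventually_elim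
          case (elim n)
          have "\<bar>(LINT \<omega>|P y. h n \<omega>) - (LINT \<omega>|P y. g \<omega>)\<bar> \<le> inverse (Suc n)" for y
            using g h(2) continuous_on_tensor_sum[OF h(1)]
            by (intro prob_space.integral_near prob integrable_P_continuous)
              (auto simp: abs_minus_commute less_imp_le)
          then show ?case using elim by (auto simp: dist_real_def intro: le_less_trans)
        qed
      qed
    qed simp
  qed
  have eqN: "(LINT \<omega>|N. g \<omega>) = (LINT y|M. (LINT \<omega>|P y. g \<omega>))"
    if g: "continuous_on UNIV g" for g :: "(nat \<Rightarrow> 'b) \<Rightarrow> real"
  proof -
    note [measurable] = borel_measurable_continuous_onI[OF g]
    have N: "(LINT \<omega>|N. g \<omega>) = (LINT \<omega>|P x. g (seq_shift \<omega>))"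
      unfolding N_def by (rule integral_distr) measurable
    interpret M: prob_space M by (rule probM)
    have M_int: "integrable M (\<lambda>y. LINT \<omega>|P y. k \<omega>)" if "continuous_on UNIV k" for k :: "(nat \<Rightarrow> 'b) \<Rightarrow> real"
      using that by (intro integrable_continuous_compact[OF comp] feller regular_borel_measureD[OF regM]) unfold_locales
    have "\<bar>(LINT \<omega>|P x. g (seq_shift \<omega>)) - (LINT y|M. (LINT \<omega>|P y. g \<omega>))\<bar> \<le> 0"
    proof (rule field_le_epsilon)
      fix e :: real assume "0 < e"
      \<comment> \<open>Both sides agree on h, and each changes by at most e / 2 when g is replaced
        by h.\<close>
      then obtain h where h: "tensor_sum h" "\<And>\<omega>. \<bar>g \<omega> - h \<omega>\<bar> < e / 2"
        using tensor_sum_dense[OF comp g, of "e / 2"] by auto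
      note hc = continuous_on_tensor_sum[OF h(1)]
      have near: "\<bar>(LINT \<omega>|P y. g \<omega>) - (LINT \<omega>|P y. h \<omega>)\<bar> \<le> e / 2" for y
        using g hc h(2) by (intro prob_space.integral_near prob integrable_P_continuous) (auto simp: less_imp_le)
      have "\<bar>(LINT \<omega>|P x. g (seq_shift \<omega>)) - (LINT \<omega>|P x. h (seq_shift \<omega>))\<bar> \<le> e / 2"
        using g hc h(2) by (intro prob_space.integral_near prob int_shift) (auto simp: less_imp_le)
      moreover have "\<bar>(LINT y|M. (LINT \<omega>|P y. g \<omega>)) - (LINT y|M. (LINT \<omega>|P y. h \<omega>))\<bar> \<le> e / 2"
        using near by (intro M.integral_near M_int g hc)
      ultimately show "\<bar>(LINT \<omega>|P x. g (seq_shift \<omega>)) - (LINT y|M. (LINT \<omega>|P y. g \<omega>))\<bar> \<le> 0 + e"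
        using sum[OF h(1)] by linarith
    qed
    then show ?thesis by (simp add: N)
  qed
  \<comment> \<open>From here on the identity is one between measures and no longer depends on
    continuity of the integrand.\<close>
  have N_bind: "N = M \<bind> P"
    using regular_measure_eq_bind[OF comp_seq comp probM regM \<open>regular_borel_measure N\<close> prob regular measurable_P feller eqN] .
  have int_f: "integrable N f"
    using ex unfolding integrals_exist_def N_def
    by (simp add: set_integrable_fiber_iff integrable_distr_eq comp_def)
  have M_ne: "space M \<noteq> {}" by (simp add: regular_borel_measureD[OF regM])
  have PM: "P \<in> measurable M (subprob_algebra borel)"
    using measurable_P regular_borel_measureD(1)[OF regM] by (simp cong: measurable_cong_sets)
  have "cond_exp_fiber P x (f \<circ> seq_shift) = (LINT \<omega>|N. f \<omega>)"
    unfolding N_def by (subst integral_distr) (simp_all add: cond_exp_fiber_eq comp_def)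
  also have "\<dots> = (LINT y|M. (LINT \<omega>|P y. f \<omega>))"
    using integral_bind_kernel[OF M_ne PM f] int_f unfolding N_bind by simp
  also have "\<dots> = borel_extension R (\<lambda>y. cond_exp_fiber P y f) x"
    unfolding borel_extension_def M_def by (simp add: cond_exp_fiber_eq)
  finally show ?thesis .
qed

text \<open>The induction hypothesis shows that \<open>E\<^sub>y f\<close> is a word, hence
  continuous in y; the Borel extension of R is then R itself, and the shift identity adds one R to
  the word. Continuous f are enough for this.\<close>

lemma shift_identity_imp_word_integral:
  fixes R :: "('b \<Rightarrow>\<^sub>C real) \<Rightarrow> ('b \<Rightarrow>\<^sub>C real)"
  assumes R: "linear R" "positive_op R" "R (const_bcontfun 1) = const_bcontfun 1"
    and shift: "\<And>x f. continuous_on UNIV f \<Longrightarrow> integrals_exist P R x f \<Longrightarrow>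
      cond_exp_fiber P x (f \<circ> seq_shift) = borel_extension R (\<lambda>y. cond_exp_fiber P y f) x"
  shows "(LINT \<omega>|P x. tensor (\<phi> # \<psi>s) \<omega>) = apply_bcontfun (alternating_word R \<phi> \<psi>s) x"
proof (induction \<psi>s arbitrary: x \<phi>)
  case Nil
  interpret prob_space "P x" by (rule prob)
  show ?case
    unfolding integral_P_Cons using prob_space by (simp add: alternating_word_def)
next
  case (Cons \<psi> \<psi>s)
  define f where "f = tensor (\<psi> # \<psi>s)"
  have f: "continuous_on UNIV f" unfolding f_def by (rule continuous_on_tensor)
  note [measurable] = borel_measurable_continuous_onI[OF f]
  have f_shift: "continuous_on UNIV (f \<circ> seq_shift)"
    using continuous_on_compose2[OF f continuous_on_seq_shift] by (simp add: comp_def)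
  note [measurable] = borel_measurable_continuous_onI[OF f_shift]
  \<comment> \<open>The induction hypothesis is used at every y and with first factor
    \<open>\<psi>\<close>, which is why x and \<open>\<phi>\<close> are generalized.\<close>
  have E: "cond_exp_fiber P y f = apply_bcontfun (alternating_word R \<psi> \<psi>s) y" for y
    using Cons.IH[where x = y and \<phi> = \<psi>] by (subst cond_exp_fiber_eq) (measurable, simp add: f_def del: tensor_Cons)
  have "integrable (repr_measure R x) (\<lambda>y. cond_exp_fiber P y f)"
    unfolding E by (intro integrable_continuous_compact[OF comp] continuous_on_apply_bcontfun
      finite_measure_regular_borel[OF comp] regular_borel_measureD regular_repr_measure[OF comp R])
  then have "integrals_exist P R x f"
    unfolding integrals_exist_def using f f_shift
    by (simp add: set_integrable_fiber_iff integrable_P_continuous)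
  then have "cond_exp_fiber P x (f \<circ> seq_shift) = apply_bcontfun (R (alternating_word R \<psi> \<psi>s)) x"
    using shift[OF f] by (simp add: borel_extension_def E integral_repr_measure[OF comp R])
  moreover have "cond_exp_fiber P x (f \<circ> seq_shift) = (LINT \<omega>|P x. f (seq_shift \<omega>))"
    using borel_measurable_continuous_onI[OF f_shift] by (subst cond_exp_fiber_eq) (simp_all add: comp_def)
  ultimately show ?case
    unfolding integral_P_Cons f_def[symmetric] by (simp add: alternating_word_def)
qed

end

theorem proposition2p17:
  fixes S :: "(nat \<Rightarrow> 'b::t2_space) measure"
    and P :: "'b \<Rightarrow> (nat \<Rightarrow> 'b) measure"
  assumes "compact (UNIV :: 'b set)"
    and "prob_space S" and "regular_borel_measure S"
    and "disintegration_proj1 S P"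
  shows
    "(\<exists>R :: ('b \<Rightarrow>\<^sub>C real) \<Rightarrow> ('b \<Rightarrow>\<^sub>C real).
        linear R \<and> positive_op R \<and> R (const_bcontfun 1) = const_bcontfun 1 \<and>
        (\<forall>x \<phi> \<psi>s. (LINT \<omega>|P x. tensor (\<phi> # \<psi>s) \<omega>) = apply_bcontfun (alternating_word R \<phi> \<psi>s) x))
     \<longleftrightarrow>
     (\<exists>R :: ('b \<Rightarrow>\<^sub>C real) \<Rightarrow> ('b \<Rightarrow>\<^sub>C real).
        linear R \<and> positive_op R \<and> R (const_bcontfun 1) = const_bcontfun 1 \<and>
        (\<forall>x. \<forall>f \<in> borel_measurable borel.
           integrable S (\<lambda>\<omega>. (f \<omega>)\<^sup>2) \<longrightarrow> integrals_exist P R x f \<longrightarrow>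
           cond_exp_fiber P x (f \<circ> seq_shift) = borel_extension R (\<lambda>y. cond_exp_fiber P y f) x))"
proof -
  note D = assms(4)[unfolded disintegration_proj1_def]
  interpret path_field P
  proof (rule path_field.intro)
    show "prob_space (P x)" "regular_borel_measure (P x)" "emeasure (P x) (fiber x) = 1" for x
      using D[THEN conjunct1, THEN spec, of x] by blast+
    show "(\<lambda>x. emeasure (P x) A) \<in> borel_measurable borel" if "A \<in> sets borel" for A
      using D[THEN conjunct2, THEN bspec, OF that] by (rule conjunct1)
  qed (rule assms(1))
  \<comment> \<open>The two conditions are equivalent for each fixed R, so the same operator
    witnesses both existential statements.\<close>
  have iff: "(\<forall>x \<phi> \<psi>s. (LINT \<omega>|P x. tensor (\<phi> # \<psi>s) \<omega>) = apply_bcontfun (alternating_word R \<phi> \<psi>s) x) \<longleftrightarrow>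
      (\<forall>x. \<forall>f \<in> borel_measurable borel.
           integrable S (\<lambda>\<omega>. (f \<omega>)\<^sup>2) \<longrightarrow> integrals_exist P R x f \<longrightarrow>
           cond_exp_fiber P x (f \<circ> seq_shift) = borel_extension R (\<lambda>y. cond_exp_fiber P y f) x)"
    if R: "linear R" "positive_op R" "R (const_bcontfun 1) = const_bcontfun 1" for R
  proof
    assume "\<forall>x \<phi> \<psi>s. (LINT \<omega>|P x. tensor (\<phi> # \<psi>s) \<omega>) = apply_bcontfun (alternating_word R \<phi> \<psi>s) x"
    then show "\<forall>x. \<forall>f \<in> borel_measurable borel.
           integrable S (\<lambda>\<omega>. (f \<omega>)\<^sup>2) \<longrightarrow> integrals_exist P R x f \<longrightarrow>
           cond_exp_fiber P x (f \<circ> seq_shift) = borel_extension R (\<lambda>y. cond_exp_fiber P y f) x"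
      using word_integral_imp_shift_identity[OF R] by blast
  next
    assume shift: "\<forall>x. \<forall>f \<in> borel_measurable borel.
           integrable S (\<lambda>\<omega>. (f \<omega>)\<^sup>2) \<longrightarrow> integrals_exist P R x f \<longrightarrow>
           cond_exp_fiber P x (f \<circ> seq_shift) = borel_extension R (\<lambda>y. cond_exp_fiber P y f) x"
    have "cond_exp_fiber P x (f \<circ> seq_shift) = borel_extension R (\<lambda>y. cond_exp_fiber P y f) x"
      if f: "continuous_on UNIV f" and ex: "integrals_exist P R x f" for x f
    proof -
      \<comment> \<open>A continuous f is bounded on the compact sequence space, so it lies in the
        class of square integrable functions that (b) speaks of.\<close>
      have "integrable S (\<lambda>\<omega>. (f \<omega>)\<^sup>2)"
        using f assms(2) regular_borel_measureD(1)[OF assms(3)]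
        by (intro integrable_continuous_compact[OF comp_seq] continuous_intros prob_space.finite_measure)
      then show ?thesis
        using shift ex borel_measurable_continuous_onI[OF f] by blast
    qed
    then show "\<forall>x \<phi> \<psi>s. (LINT \<omega>|P x. tensor (\<phi> # \<psi>s) \<omega>) = apply_bcontfun (alternating_word R \<phi> \<psi>s) x"
      using shift_identity_imp_word_integral[OF R] by blast
  qed
  show ?thesis
    by (rule iff_exI, intro conj_cong refl, rule iff; assumption)
qed

end
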